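(* Let $m\geq 2$, $q\geq 2$ and let $C$ be one of the following codes in $H(m,q)$: (i) $\mathrm{Rep}(m,q)$; (ii) $\mathrm{Inj}(m,q)$ with $m<q$; (iii) $W([m/2],2)$ with $q=2$ and $m\geq 3$ odd; (iv) $\mathrm{All}(pq,q)$ with $m=pq$ for a positive integer $p$. Then $C$ is neighbour transitive and $\mathrm{Aut}(C)=\mathrm{Diag}_m(S_q)\rtimes L$. Moreover, the minimum distance of $C$ is $m$, $1$, $1$, $2$ in cases (i), (ii), (iii), (iv) respectively.
   Context: $H(m,q)$ is the Hamming graph on $Q^m$, $|Q|=q$, adjacency = differing in exactly one entry. Its automorphism group is $B\rtimes L$ with $B\cong S_q^m$ acting entrywise and $L\cong S_m$ permuting entries; $\mathrm{Diag}_m(S_q)=\{(h,\ldots,h):h\in S_q\}\leq B$. $\mathrm{Aut}(C)$ is the setwise stabiliser of $C$. $C_1$ is the set of non-codewords adjacent to a codeword; $C$ is neighbour transitive if $C$ and $C_1$ are both orbits of some group of automorphisms. $\mathrm{Rep}(m,q)=\{(a,\ldots,a):a\in Q\}$; $\mathrm{Inj}(m,q)$ is the set of vertices with pairwise distinct entries; for $Q=\{0,1\}$, $W([m/2],2)$ is the set of vertices with exactly $(m-1)/2$ or $(m+1)/2$ entries equal to $1$; $\mathrm{All}(pq,q)$ is the set of vertices of $H(pq,q)$ in which every letter of $Q$ occurs exactly $p$ times. *)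

theory Defs
  imports "HOL-Algebra.Group_Action" "HOL-Combinatorics.Permutations"
begin

section \<open>Hamming graphs\<close>

text \<open>The entries of a vertex of \<open>H(m,q)\<close> are indexed by \<open>{1..m}\<close>, and the alphabet is a set
  \<open>Q\<close> of size \<open>q\<close>.\<close>

definition hamming_vertices :: "nat \<Rightarrow> 'a set \<Rightarrow> (nat \<Rightarrow> 'a) set" where
  "hamming_vertices m Q = {1..m} \<rightarrow>\<^sub>E Q"

definition hamming_dist :: "nat \<Rightarrow> (nat \<Rightarrow> 'a) \<Rightarrow> (nat \<Rightarrow> 'a) \<Rightarrow> nat" where
  "hamming_dist m x y = card {i \<in> {1..m}. x i \<noteq> y i}"

definition hamming_adj :: "nat \<Rightarrow> (nat \<Rightarrow> 'a) \<Rightarrow> (nat \<Rightarrow> 'a) \<Rightarrow> bool" where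
  "hamming_adj m x y \<longleftrightarrow> hamming_dist m x y = 1"

text \<open>This is the full group of graph automorphisms of \<open>H(m,q)\<close>; that it equals \<open>B \<rtimes> L\<close> is
  not built into the definition.\<close>

definition hamming_aut ::
    "nat \<Rightarrow> 'a set \<Rightarrow> ((nat \<Rightarrow> 'a) \<Rightarrow> (nat \<Rightarrow> 'a)) monoid" where
  "hamming_aut m Q = BijGroup (hamming_vertices m Q)
     \<lparr>carrier := {g \<in> Bij (hamming_vertices m Q).
        \<forall>x \<in> hamming_vertices m Q. \<forall>y \<in> hamming_vertices m Q.
          hamming_adj m (g x) (g y) \<longleftrightarrow> hamming_adj m x y}\<rparr>"

definition diag_group :: "nat \<Rightarrow> 'a set \<Rightarrow> ((nat \<Rightarrow> 'a) \<Rightarrow> (nat \<Rightarrow> 'a)) set" where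
  "diag_group m Q =
     {\<lambda>x \<in> hamming_vertices m Q. \<lambda>i \<in> {1..m}. h (x i) | h. h permutes Q}"

text \<open>The permutation \<open>\<sigma>\<close> moves the entry in position \<open>i\<close> to position \<open>\<sigma> i\<close>.\<close>

definition entry_perm_group :: "nat \<Rightarrow> 'a set \<Rightarrow> ((nat \<Rightarrow> 'a) \<Rightarrow> (nat \<Rightarrow> 'a)) set" where
  "entry_perm_group m Q =
     {\<lambda>x \<in> hamming_vertices m Q. \<lambda>i \<in> {1..m}. x (inv_into UNIV \<sigma> i) | \<sigma>. \<sigma> permutes {1..m}}"

definition internal_semidirect_product ::
    "('g, 'b) monoid_scheme \<Rightarrow> 'g set \<Rightarrow> 'g set \<Rightarrow> bool" where
  "internal_semidirect_product G N K \<longleftrightarrow>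
     N \<lhd> G \<and> subgroup K G \<and> N \<inter> K = {\<one>\<^bsub>G\<^esub>} \<and> N <#>\<^bsub>G\<^esub> K = carrier G"

section \<open>Codes\<close>

text \<open>The setwise stabiliser of a code is its stabiliser under the induced action on sets of
  vertices.\<close>

definition code_aut ::
    "nat \<Rightarrow> 'a set \<Rightarrow> (nat \<Rightarrow> 'a) set \<Rightarrow> ((nat \<Rightarrow> 'a) \<Rightarrow> (nat \<Rightarrow> 'a)) monoid" where
  "code_aut m Q C =
     (hamming_aut m Q) \<lparr>carrier := stabilizer (hamming_aut m Q) (\<lambda>g S. g ` S) C\<rparr>"

definition code_neighbours ::
    "nat \<Rightarrow> 'a set \<Rightarrow> (nat \<Rightarrow> 'a) set \<Rightarrow> (nat \<Rightarrow> 'a) set" where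
  "code_neighbours m Q C =
     {x \<in> hamming_vertices m Q. x \<notin> C \<and> (\<exists>y \<in> C. hamming_adj m x y)}"

definition neighbour_transitive :: "nat \<Rightarrow> 'a set \<Rightarrow> (nat \<Rightarrow> 'a) set \<Rightarrow> bool" where
  "neighbour_transitive m Q C \<longleftrightarrow>
     (\<exists>X. subgroup X (hamming_aut m Q) \<and>
          {C, code_neighbours m Q C} \<subseteq>
            orbits ((hamming_aut m Q) \<lparr>carrier := X\<rparr>) (hamming_vertices m Q) (\<lambda>g. g))"

text \<open>The value is meaningful only for codes with at least two codewords.\<close>

definition min_distance :: "nat \<Rightarrow> (nat \<Rightarrow> 'a) set \<Rightarrow> nat" where
  "min_distance m C = Min {hamming_dist m x y | x y. x \<in> C \<and> y \<in> C \<and> x \<noteq> y}"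

definition rep_code :: "nat \<Rightarrow> 'a set \<Rightarrow> (nat \<Rightarrow> 'a) set" where
  "rep_code m Q = {\<lambda>i \<in> {1..m}. a | a. a \<in> Q}"

definition inj_code :: "nat \<Rightarrow> 'a set \<Rightarrow> (nat \<Rightarrow> 'a) set" where
  "inj_code m Q = {x \<in> hamming_vertices m Q. inj_on x {1..m}}"

text \<open>Here \<open>u\<close> and \<open>v\<close> play the roles of the letters 0 and 1 of a binary alphabet, and \<open>m\<close> is
  meant to be odd, so that both divisions are exact.\<close>

definition middle_weight_code :: "nat \<Rightarrow> 'a \<Rightarrow> 'a \<Rightarrow> (nat \<Rightarrow> 'a) set" where
  "middle_weight_code m u v =
     {x \<in> hamming_vertices m {u, v}.
        card {i \<in> {1..m}. x i = v} \<in> {(m - 1) div 2, (m + 1) div 2}}"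

text \<open>The code \<open>All(pq,q)\<close>, where \<open>m = p * q\<close> and \<open>q = card Q\<close>.\<close>

definition all_code :: "nat \<Rightarrow> nat \<Rightarrow> 'a set \<Rightarrow> (nat \<Rightarrow> 'a) set" where
  "all_code m p Q =
     {x \<in> hamming_vertices m Q. \<forall>a \<in> Q. card {i \<in> {1..m}. x i = a} = p}"

end

theory Submission
  imports Defs
begin

text \<open>
  Adjacent vertices differ in one entry, which gives every edge a direction. A graph automorphism
  maps triangles to triangles and induced squares to induced squares, so parallel edges have parallel
  images; hence it permutes the directions and acts on each entry by its own permutation
  \<open>h\<^sub>i\<close> of the alphabet. If it stabilises one of the codes, all \<open>h\<^sub>i\<close> agree: for repetition and
  injective words this can be read off single codewords; otherwise swap distinct entries \<open>a\<close>, \<open>b\<close>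
  in positions \<open>i\<close>, \<open>j\<close> of a codeword and compare the multiplicities of the letter \<open>h\<^sub>i a\<close> in the two
  images. Transitivity holds because a word is determined, up to permuting entries and letters, by
  its partition of the positions, and up to permuting entries by its letter multiplicities.
\<close>

section \<open>Permutations and groups of bijections\<close>

text \<open>One group serves all four codes: the maps \<open>mon h \<sigma>\<close> with a single
  letter permutation. It stabilises each code, it already acts transitively on C and on C_1, and it
  is the witness for neighbour transitivity. What remains is that nothing else stabilises C, and
  there the count comparison meets an obstacle. The swap lowers the multiplicity of
  \<open>h i a\<close> by one or by two, and a drop by one refutes nothing for middle weights, where
  k and k + 1 are both allowed. But a two-letter alphabet forces \<open>h j b = h i a\<close>, and
  then the drop is two. In All every multiplicity is p, so any drop is a contradiction.\<close>

lemma extend_to_permutation: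
  assumes "finite S" "A \<subseteq> S" "inj_on f A" "f ` A \<subseteq> S"
  shows "\<exists>p. p permutes S \<and> (\<forall>x \<in> A. p x = f x)"
proof -
  have "card (S - A) = card (S - f ` A)"
    using assms by (simp add: card_Diff_subset card_image finite_subset)
  then obtain g where g: "bij_betw g (S - A) (S - f ` A)"
    using assms(1) finite_same_card_bij by blast
  define p where "p x = (if x \<in> A then f x else if x \<in> S then g x else x)" for x
  have "bij_betw p A (f ` A)"
    using bij_betw_imageI[OF assms(3) refl]
    by (rule bij_betw_cong[THEN iffD1, rotated]) (simp add: p_def)
  moreover have "bij_betw p (S - A) (S - f ` A)"
    using g by (rule bij_betw_cong[THEN iffD1, rotated]) (simp add: p_def)
  ultimately have "bij_betw p (A \<union> (S - A)) (f ` A \<union> (S - f ` A))"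
    by (rule bij_betw_combine) auto
  moreover have "A \<union> (S - A) = S" "f ` A \<union> (S - f ` A) = S" using assms by auto
  ultimately have "p permutes S"
    using assms(2) by (intro bij_imp_permutes) (auto simp: p_def)
  then show ?thesis by (intro exI[of _ p]) (simp add: p_def)
qed

lemma equal_fibre_cards_imp_permutes:
  assumes "finite S" and "\<And>a. card {i \<in> S. f i = a} = card {i \<in> S. f' i = a}"
  shows "\<exists>p. p permutes S \<and> (\<forall>i \<in> S. f i = f' (p i))"
proof -
  \<comment> \<open>The fibre sizes are the multiplicities in the multiset of values, and equal
    multisets are matched by a permutation of the index set.\<close>
  have "image_mset f (mset_set S) = image_mset f' (mset_set S)"
  proof (rule multiset_eqI)
    fix a
    have "count (image_mset k (mset_set S)) a = card {i \<in> S. k i = a}" for k :: "'a \<Rightarrow> 'b"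
    proof -
      have "count (image_mset k (mset_set S)) a = card {i \<in> S. a = k i}"
        using assms(1) by (simp add: count_image_mset')
      also have "{i \<in> S. a = k i} = {i \<in> S. k i = a}" by blast
      finally show ?thesis .
    qed
    then show "count (image_mset f (mset_set S)) a = count (image_mset f' (mset_set S)) a"
      using assms(2) by presburger
  qed
  then show ?thesis by (meson image_mset_eq_implies_permutes[OF assms(1)])
qed

lemma subgroup_BijGroupI:
  assumes "H \<subseteq> Bij S" "H \<noteq> {}"
    and "\<And>f g. f \<in> H \<Longrightarrow> g \<in> H \<Longrightarrow> compose S f g \<in> H"
    and "\<And>f. f \<in> H \<Longrightarrow> (\<lambda>x\<in>S. inv_into S f x) \<in> H"
  shows "subgroup H (BijGroup S)"
proof (rule group.subgroupI[OF group_BijGroup])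
  show "H \<subseteq> carrier (BijGroup S)" using assms(1) by (simp add: BijGroup_def)
  show "inv\<^bsub>BijGroup S\<^esub> f \<in> H" if "f \<in> H" for f
    using that assms by (auto simp: inv_BijGroup)
  show "f \<otimes>\<^bsub>BijGroup S\<^esub> g \<in> H" if "f \<in> H" "g \<in> H" for f g
    using that assms by (auto simp: BijGroup_def subset_iff)
qed fact

lemma two_points_permutation:
  assumes "finite S" "a \<in> S" "b \<in> S" "a \<noteq> b" "c \<in> S" "d \<in> S" "c \<noteq> d"
  obtains p where "p permutes S" "p a = c" "p b = d"
proof -
  have "\<exists>p. p permutes S \<and> (\<forall>x \<in> {a, b}. p x = (if x = a then c else d))"
    using assms by (intro extend_to_permutation) auto
  then show thesis using that assms(4) by auto
qed

section \<open>Hamming graphs and their automorphisms\<close>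

locale hamming_graph =
  fixes m :: nat and Q :: "'a set"
  assumes finite_Q: "finite Q" and m_ge: "2 \<le> m" and card_Q: "2 \<le> card Q"
begin

abbreviation V :: "(nat \<Rightarrow> 'a) set" where "V \<equiv> hamming_vertices m Q"

text \<open>The distance is only the size of this set; the set also keeps the direction
  \<open>i\<close> of an edge, for which \<open>diffs x y = {i}\<close>.\<close>

definition diffs :: "(nat \<Rightarrow> 'a) \<Rightarrow> (nat \<Rightarrow> 'a) \<Rightarrow> nat set" where
  "diffs x y = {i \<in> {1..m}. x i \<noteq> y i}"

lemma diffs_sym: "diffs x y = diffs y x"
  by (auto simp: diffs_def)

lemma diffs_subset: "diffs x y \<subseteq> {1..m}"
  by (auto simp: diffs_def)

lemma diffs_triangle: "diffs y z \<subseteq> diffs x y \<union> diffs x z"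
  by (auto simp: diffs_def)

lemma diffs_transfer: "k \<in> diffs x y \<Longrightarrow> k \<notin> diffs x z \<Longrightarrow> k \<in> diffs y z"
  by (auto simp: diffs_def)

lemma diffs_singletonD: "diffs x y = {i} \<Longrightarrow> k \<in> {1..m} \<Longrightarrow> k \<noteq> i \<Longrightarrow> x k = y k"
  by (auto simp: diffs_def)

lemma adj_iff_diffs: "hamming_adj m x y \<longleftrightarrow> (\<exists>i. diffs x y = {i})"
  by (simp add: hamming_adj_def hamming_dist_def diffs_def card_1_singleton_iff)

lemma vertex_in: "x \<in> V \<Longrightarrow> i \<in> {1..m} \<Longrightarrow> x i \<in> Q"
  by (auto simp: hamming_vertices_def PiE_iff)

lemma vertex_eqI: "x \<in> V \<Longrightarrow> y \<in> V \<Longrightarrow> (\<And>i. i \<in> {1..m} \<Longrightarrow> x i = y i) \<Longrightarrow> x = y"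
  unfolding hamming_vertices_def by (rule PiE_ext)

lemma vertex_upd: "x \<in> V \<Longrightarrow> i \<in> {1..m} \<Longrightarrow> a \<in> Q \<Longrightarrow> x(i := a) \<in> V"
  by (auto simp: hamming_vertices_def PiE_iff extensional_def)

lemma diffs_upd: "i \<in> {1..m} \<Longrightarrow> a \<noteq> x i \<Longrightarrow> diffs x (x(i := a)) = {i}"
  by (auto simp: diffs_def)

lemma diffs_empty_iff: "x \<in> V \<Longrightarrow> y \<in> V \<Longrightarrow> diffs x y = {} \<longleftrightarrow> x = y"
  by (auto simp: diffs_def intro: vertex_eqI)

lemma finite_V: "finite V"
  unfolding hamming_vertices_def by (intro finite_PiE) (auto simp: finite_Q)

subsection \<open>Automorphisms of the Hamming graph\<close>

context
  fixes g :: "(nat \<Rightarrow> 'a) \<Rightarrow> (nat \<Rightarrow> 'a)"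
  assumes g_bij: "bij_betw g V V"
    and g_adj: "\<And>x y. x \<in> V \<Longrightarrow> y \<in> V \<Longrightarrow> hamming_adj m (g x) (g y) \<longleftrightarrow> hamming_adj m x y"
begin

lemma g_in: "x \<in> V \<Longrightarrow> g x \<in> V"
  using g_bij by (auto simp: bij_betw_def)

lemma g_neq: "x \<in> V \<Longrightarrow> y \<in> V \<Longrightarrow> x \<noteq> y \<Longrightarrow> g x \<noteq> g y"
  using g_bij by (auto simp: bij_betw_def inj_on_def)

lemma g_edge:
  assumes "x \<in> V" "y \<in> V" "diffs x y = {i}"
  obtains s where "diffs (g x) (g y) = {s}"
  using g_adj[OF assms(1,2)] assms(3) unfolding adj_iff_diffs by auto

text \<open>If the directions agreed, \<open>g y\<close> and \<open>g z\<close> would lie on one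
  line through \<open>g x\<close> and be adjacent, although \<open>y\<close> and \<open>z\<close>
  differ at both \<open>i\<close> and \<open>j\<close>.\<close>

lemma g_directions_distinct:
  assumes V: "x \<in> V" "y \<in> V" "z \<in> V"
    and xy: "diffs x y = {i}" and xz: "diffs x z = {j}" and "i \<noteq> j"
  shows "diffs (g x) (g y) \<noteq> diffs (g x) (g z)"
proof
  assume eq: "diffs (g x) (g y) = diffs (g x) (g z)"
  obtain s where s: "diffs (g x) (g y) = {s}" using g_edge[OF V(1,2) xy] .
  have ij: "i \<in> diffs y z" "j \<in> diffs y z"
    using diffs_transfer[of i x y z] diffs_transfer[of j x z y] xy xz \<open>i \<noteq> j\<close>
    by (auto simp: diffs_sym)
  then have nadj: "\<not> hamming_adj m y z"
    using \<open>i \<noteq> j\<close> unfolding adj_iff_diffs by auto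
  have "y \<noteq> z" using ij(1) by (auto simp: diffs_def)
  have "diffs (g y) (g z) \<noteq> {}"
    using g_neq[OF V(2,3) \<open>y \<noteq> z\<close>] V g_in by (simp add: diffs_empty_iff)
  moreover have "diffs (g y) (g z) \<subseteq> {s}"
    using s eq diffs_triangle[of "g y" "g z" "g x"] by auto
  ultimately have "diffs (g y) (g z) = {s}" by auto
  with g_adj[OF V(2,3)] nadj show False unfolding adj_iff_diffs by auto
qed

text \<open>A triangle cannot have edges in different directions, since the third edge would join vertices
  at distance two.\<close>

lemma g_line:
  assumes V: "x \<in> V" "y \<in> V" "z \<in> V"
    and xy: "diffs x y = {i}" and xz: "diffs x z = {i}"
  shows "diffs (g x) (g y) = diffs (g x) (g z)"
proof (cases "y = z")
  case False
  then have "diffs y z \<noteq> {}" using V by (simp add: diffs_empty_iff)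
  moreover have "diffs y z \<subseteq> {i}" using xy xz diffs_triangle[of y z x] by auto
  ultimately have yz: "diffs y z = {i}" by auto
  obtain s where s: "diffs (g x) (g y) = {s}" using g_edge[OF V(1,2) xy] .
  obtain t where t: "diffs (g x) (g z) = {t}" using g_edge[OF V(1,3) xz] .
  obtain u where u: "diffs (g y) (g z) = {u}" using g_edge[OF V(2,3) yz] .
  have "s = t"
  proof (rule ccontr)
    assume "s \<noteq> t"
    then have "s \<in> diffs (g y) (g z)" "t \<in> diffs (g y) (g z)"
      using s t diffs_transfer[of s "g x" "g y" "g z"] diffs_transfer[of t "g x" "g z" "g y"]
      by (auto simp: diffs_sym)
    with u \<open>s \<noteq> t\<close> show False by auto
  qed
  with s t show ?thesis by simp
qed simp

text \<open>The diagonals of a square are non-adjacent, so neighbouring edges of its image have distinct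
  directions.\<close>

lemma g_square:
  assumes V: "x \<in> V" "y \<in> V" "z \<in> V" "w \<in> V" and "i \<noteq> j"
    and xy: "diffs x y = {i}" and xz: "diffs x z = {j}"
    and zw: "diffs z w = {i}" and yw: "diffs y w = {j}"
  shows "diffs (g z) (g w) = diffs (g x) (g y)"
proof -
  obtain s where s: "diffs (g x) (g y) = {s}" using g_edge[OF V(1,2) xy] .
  obtain t where t: "diffs (g x) (g z) = {t}" using g_edge[OF V(1,3) xz] .
  obtain u where u: "diffs (g y) (g w) = {u}" using g_edge[OF V(2,4) yw] .
  obtain v where v: "diffs (g z) (g w) = {v}" using g_edge[OF V(3,4) zw] .
  have "s \<noteq> t" using g_directions_distinct[OF V(1-3) xy xz \<open>i \<noteq> j\<close>] s t by auto
  \<comment> \<open>Position \<open>s\<close> separates \<open>g y\<close> from \<open>g z\<close>,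
    so the path through \<open>g w\<close> must change it; the edge at \<open>g y\<close> does not,
    which leaves the edge at \<open>g z\<close>.\<close>
  then have "s \<in> diffs (g y) (g z)" using s t diffs_transfer[of s "g x" "g y" "g z"] by auto
  then have "s \<in> diffs (g y) (g w) \<union> diffs (g z) (g w)"
    using diffs_triangle[of "g y" "g z" "g w"] by (auto simp: diffs_sym)
  moreover have "s \<noteq> u"
    using g_directions_distinct[OF V(2,1,4) _ yw \<open>i \<noteq> j\<close>] xy s u by (simp add: diffs_sym)
  ultimately show ?thesis using u v s by auto
qed

text \<open>Induction on the number of entries other than \<open>i\<close> in which the base points
  differ: a square carries the edge one such entry closer to \<open>x'\<close>, and at the end both
  edges lie on one line.\<close>

lemma g_direction_unique:
  assumes "x \<in> V" "y \<in> V" "x' \<in> V" "y' \<in> V" "diffs x y = {i}" "diffs x' y' = {i}"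
  shows "diffs (g x) (g y) = diffs (g x') (g y')"
  using assms
proof (induction "card (diffs x x' - {i})" arbitrary: x y)
  case 0
  have "finite (diffs x x')" by (simp add: diffs_def)
  with 0 have sub: "diffs x x' \<subseteq> {i}" by auto
  show ?case
  proof (cases "x = x'")
    case True
    with g_line 0 show ?thesis by metis
  next
    case False
    \<comment> \<open>Both edges lie on the line through \<open>x\<close> and \<open>x'\<close>, so
      each is compared with the edge joining these two.\<close>
    with sub have xx: "diffs x x' = {i}" using diffs_empty_iff 0 by blast
    have "diffs (g x) (g y) = diffs (g x') (g x)"
      using g_line[OF \<open>x \<in> V\<close> \<open>y \<in> V\<close> \<open>x' \<in> V\<close> _ xx] 0 by (simp add: diffs_sym)
    also have "\<dots> = diffs (g x') (g y')"
      using 0 xx by (intro g_line) (auto simp: diffs_sym)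
    finally show ?thesis .
  qed
next
  case (Suc n)
  then obtain j where j: "j \<in> diffs x x'" "j \<noteq> i"
    by (metis Diff_iff card_eq_0_iff equals0I nat.distinct(1) singletonI)
  then have jm: "j \<in> {1..m}" "x j \<noteq> x' j" by (auto simp: diffs_def)
  \<comment> \<open>The edge from \<open>x\<close> to \<open>y\<close> shifted in direction
    \<open>j\<close>. As \<open>j \<noteq> i\<close>, the words \<open>x\<close> and
    \<open>y\<close> agree at \<open>j\<close>, so the four words form a square.\<close>
  define z where "z = x(j := x' j)"
  define w where "w = y(j := x' j)"
  have "y j = x j" using diffs_singletonD[OF Suc.prems(5), of j] j jm by simp
  have V: "z \<in> V" "w \<in> V" unfolding z_def w_def
    using Suc.prems jm vertex_in vertex_upd by auto
  have xz: "diffs x z = {j}" and yw: "diffs y w = {j}"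
    unfolding z_def w_def using jm \<open>y j = x j\<close> by (auto intro!: diffs_upd)
  have zw: "diffs z w = {i}"
  proof -
    have "diffs z w = diffs x y - {j}" unfolding diffs_def z_def w_def by auto
    then show ?thesis using Suc.prems(5) \<open>j \<noteq> i\<close> by simp
  qed
  have "diffs x x' - {i} = insert j (diffs z x' - {i})"
    using j jm unfolding diffs_def z_def by auto
  moreover have "j \<notin> diffs z x'" unfolding z_def diffs_def by auto
  moreover have "finite (diffs z x')" by (simp add: diffs_def)
  ultimately have "n = card (diffs z x' - {i})" using Suc.hyps(2) by simp
  then have "diffs (g z) (g w) = diffs (g x') (g y')"
    using Suc.hyps(1)[OF _ V Suc.prems(3,4) zw] Suc.prems(6) by blast
  with g_square[OF Suc.prems(1,2) V j(2)[symmetric] Suc.prems(5) xz zw yw] show ?case by simp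
qed

text \<open>The letter of \<open>g x\<close> at \<open>\<tau> i\<close> depends only on
  \<open>x i\<close>, so each \<open>h i\<close> can be read off from a fixed word in which entry
  \<open>i\<close> varies.\<close>

lemma aut_decomposition:
  obtains \<tau> h where "bij_betw \<tau> {1..m} {1..m}"
    and "\<And>i. i \<in> {1..m} \<Longrightarrow> h i ` Q \<subseteq> Q"
    and "\<And>i. i \<in> {1..m} \<Longrightarrow> inj_on (h i) Q"
    and "\<And>x i. x \<in> V \<Longrightarrow> i \<in> {1..m} \<Longrightarrow> g x (\<tau> i) = h i (x i)"
proof -
  obtain a b where ab: "a \<in> Q" "b \<in> Q" "a \<noteq> b"
    using card_Q finite_Q by (metis card_le_Suc0_iff_eq not_less_eq_eq numeral_2_eq_2)
  \<comment> \<open>A base word; replacing one entry by \<open>b\<close> supplies an edge in every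
    direction.\<close>
  define e where "e = (\<lambda>i\<in>{1..m}. a)"
  have e: "e \<in> V" unfolding e_def hamming_vertices_def using ab by auto
  have "\<exists>s. \<forall>x\<in>V. \<forall>y\<in>V. diffs x y = {i} \<longrightarrow> diffs (g x) (g y) = {s}"
    if i: "i \<in> {1..m}" for i
  proof -
    have e': "e(i := b) \<in> V" "diffs e (e(i := b)) = {i}"
      using i e ab vertex_upd[OF e i] diffs_upd[OF i, of b e] by (auto simp: e_def)
    obtain s where "diffs (g e) (g (e(i := b))) = {s}" using g_edge[OF e e'] .
    with e e' show ?thesis by (metis g_direction_unique)
  qed
  then obtain \<tau> where \<tau>: "\<And>i x y. i \<in> {1..m} \<Longrightarrow> x \<in> V \<Longrightarrow> y \<in> V \<Longrightarrow> diffs x y = {i} \<Longrightarrow>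
      diffs (g x) (g y) = {\<tau> i}"
    by metis
  have upd: "e(i := b) \<in> V \<and> diffs e (e(i := b)) = {i}" if "i \<in> {1..m}" for i
    using that e ab vertex_upd[OF e that] diffs_upd[OF that, of b e] by (auto simp: e_def)
  have \<tau>_in: "\<tau> i \<in> {1..m}" if "i \<in> {1..m}" for i
    using \<tau>[OF that e, of "e(i := b)"] upd[OF that] diffs_subset by blast
  have \<tau>_inj: "inj_on \<tau> {1..m}"
  proof (rule inj_onI, rule ccontr)
    fix i j assume ij: "i \<in> {1..m}" "j \<in> {1..m}" "\<tau> i = \<tau> j" "i \<noteq> j"
    from upd[OF ij(1)] upd[OF ij(2)] ij \<tau>[OF ij(1) e, of "e(i := b)"] \<tau>[OF ij(2) e, of "e(j := b)"]
      g_directions_distinct[OF e, of "e(i := b)" "e(j := b)" i j]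
    show False by auto
  qed
  have \<tau>_bij: "bij_betw \<tau> {1..m} {1..m}"
    unfolding bij_betw_def using \<tau>_inj \<tau>_in
    by (intro conjI endo_inj_surj) blast+
  \<comment> \<open>Turn \<open>x\<close> into \<open>y\<close> one entry at a time. Entry
    \<open>i\<close> is never touched, so no image edge has direction
    \<open>\<tau> i\<close>.\<close>
  have local: "g x (\<tau> i) = g y (\<tau> i)"
    if "x \<in> V" "y \<in> V" "i \<in> {1..m}" "x i = y i" for x y i
    using that
  proof (induction "card (diffs x y)" arbitrary: x)
    case 0
    have "finite (diffs x y)" by (simp add: diffs_def)
    with 0 have "x = y" using diffs_empty_iff by auto
    then show ?case by simp
  next
    case (Suc n)
    then obtain j where j: "j \<in> diffs x y"
      by (metis card_eq_0_iff equals0I nat.distinct(1))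
    then have jm: "j \<in> {1..m}" "x j \<noteq> y j" by (auto simp: diffs_def)
    define z where "z = x(j := y j)"
    have z: "z \<in> V" unfolding z_def using Suc.prems jm vertex_in vertex_upd by auto
    have "diffs x z = {j}" unfolding z_def using jm by (auto intro!: diffs_upd)
    then have gxz: "diffs (g x) (g z) = {\<tau> j}" using \<tau> jm Suc.prems z by auto
    have "i \<noteq> j" using jm Suc.prems(4) by auto
    then have "\<tau> i \<noteq> \<tau> j"
      using inj_onD[OF \<tau>_inj _ Suc.prems(3) jm(1)] by blast
    then have "g x (\<tau> i) = g z (\<tau> i)"
      by (rule diffs_singletonD[OF gxz \<tau>_in[OF Suc.prems(3)]])
    moreover have "diffs x y = insert j (diffs z y)" "j \<notin> diffs z y" "finite (diffs z y)"
      using j jm unfolding diffs_def z_def by auto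
    then have "n = card (diffs z y)" using Suc.hyps(2) by simp
    then have "g z (\<tau> i) = g y (\<tau> i)"
      using Suc.hyps(1)[OF _ z] Suc.prems by (auto simp: z_def)
    ultimately show ?case by simp
  qed
  \<comment> \<open>By \<open>local\<close>, the base word may stand for any other word with letter
    \<open>c\<close> at position \<open>i\<close>.\<close>
  define h where "h i c = g (e(i := c)) (\<tau> i)" for i c
  show thesis
  proof
    show "bij_betw \<tau> {1..m} {1..m}" by (rule \<tau>_bij)
    show "h i ` Q \<subseteq> Q" if "i \<in> {1..m}" for i
      unfolding h_def using that vertex_in[OF g_in[OF vertex_upd[OF e that]] \<tau>_in[OF that]] by auto
    show "inj_on (h i) Q" if i: "i \<in> {1..m}" for i
    proof (rule inj_onI, rule ccontr)
      fix c d assume cd: "c \<in> Q" "d \<in> Q" "h i c = h i d" "c \<noteq> d"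
      have "diffs (e(i := c)) (e(i := d)) = {i}" using cd i by (auto simp: diffs_def)
      with \<tau>[OF i] cd i e vertex_upd have "diffs (g (e(i := c))) (g (e(i := d))) = {\<tau> i}" by auto
      then have "\<tau> i \<in> diffs (g (e(i := c))) (g (e(i := d)))" by simp
      with cd show False unfolding h_def diffs_def by simp
    qed
    show "g x (\<tau> i) = h i (x i)" if "x \<in> V" "i \<in> {1..m}" for x i
      unfolding h_def using that e vertex_in vertex_upd by (intro local) auto
  qed
qed

end

section \<open>The automorphism group inside the group of all bijections of V\<close>

definition aut_set :: "((nat \<Rightarrow> 'a) \<Rightarrow> (nat \<Rightarrow> 'a)) set" where
  "aut_set = {g \<in> Bij V. \<forall>x \<in> V. \<forall>y \<in> V. hamming_adj m (g x) (g y) \<longleftrightarrow> hamming_adj m x y}"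

lemma hamming_aut_eq: "hamming_aut m Q = BijGroup V \<lparr>carrier := aut_set\<rparr>"
  by (simp add: hamming_aut_def aut_set_def)

lemma aut_set_subgroup: "subgroup aut_set (BijGroup V)"
proof (rule subgroup_BijGroupI)
  show "aut_set \<subseteq> Bij V" by (auto simp: aut_set_def)
  have "(\<lambda>x\<in>V. x) \<in> aut_set" by (simp add: aut_set_def id_Bij)
  then show "aut_set \<noteq> {}" by blast
  show "compose V f g \<in> aut_set" if "f \<in> aut_set" "g \<in> aut_set" for f g
  proof -
    have "g x \<in> V" if "x \<in> V" for x
      using that \<open>g \<in> aut_set\<close> Bij_imp_funcset[of g V] by (auto simp: aut_set_def)
    then show ?thesis using that by (simp add: aut_set_def compose_Bij compose_eq)
  qed
  show "(\<lambda>x\<in>V. inv_into V f x) \<in> aut_set" if f: "f \<in> aut_set" for f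
  proof -
    have B: "f \<in> Bij V" using f by (simp add: aut_set_def)
    then have *: "inv_into V f x \<in> V" "f (inv_into V f x) = x" if "x \<in> V" for x
      using that by (auto simp: Bij_def bij_betw_def inv_into_into f_inv_into_f)
    have "hamming_adj m (inv_into V f x) (inv_into V f y) \<longleftrightarrow> hamming_adj m x y"
      if "x \<in> V" "y \<in> V" for x y
      using f *[OF that(1)] *[OF that(2)] unfolding aut_set_def by force
    then show ?thesis using restrict_inv_into_Bij[OF B] by (simp add: aut_set_def)
  qed
qed

subsection \<open>Monomial maps with constant letter permutation\<close>

text \<open>The permutation \<open>\<sigma>\<close> is applied to the index without inversion, so that products of maps
  \<open>mon h \<sigma>\<close> reverse the order of the permutations of the entries.\<close>

definition mon :: "('a \<Rightarrow> 'a) \<Rightarrow> (nat \<Rightarrow> nat) \<Rightarrow> (nat \<Rightarrow> 'a) \<Rightarrow> (nat \<Rightarrow> 'a)" where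
  "mon h \<sigma> = (\<lambda>x \<in> V. \<lambda>i \<in> {1..m}. h (x (\<sigma> i)))"

text \<open>The product of Diag_m(S_q) and L as a set of maps; it turns out to be the stabiliser of
  each of the four codes.\<close>

definition mons :: "((nat \<Rightarrow> 'a) \<Rightarrow> (nat \<Rightarrow> 'a)) set" where
  "mons = {mon h \<sigma> | h \<sigma>. h permutes Q \<and> \<sigma> permutes {1..m}}"

lemma monsI: "h permutes Q \<Longrightarrow> \<sigma> permutes {1..m} \<Longrightarrow> mon h \<sigma> \<in> mons"
  by (auto simp: mons_def)

lemma monsE:
  assumes "g \<in> mons"
  obtains h \<sigma> where "h permutes Q" "\<sigma> permutes {1..m}" "g = mon h \<sigma>"
  using assms unfolding mons_def by blast

lemma mon_apply: "x \<in> V \<Longrightarrow> i \<in> {1..m} \<Longrightarrow> mon h \<sigma> x i = h (x (\<sigma> i))"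
  by (simp add: mon_def)

lemma mon_in:
  assumes "h permutes Q" "\<sigma> permutes {1..m}" "x \<in> V"
  shows "mon h \<sigma> x \<in> V"
proof -
  have "h (x (\<sigma> i)) \<in> Q" if "i \<in> {1..m}" for i
    using permutes_in_image[OF assms(1)] permutes_in_image[OF assms(2)] vertex_in[OF assms(3)] that
    by metis
  then show ?thesis using assms(3) by (simp add: mon_def hamming_vertices_def)
qed

lemma mon_compose:
  assumes "h' permutes Q" "\<sigma> permutes {1..m}" "\<sigma>' permutes {1..m}"
  shows "compose V (mon h \<sigma>) (mon h' \<sigma>') = mon (h \<circ> h') (\<sigma>' \<circ> \<sigma>)"
proof
  fix x
  show "compose V (mon h \<sigma>) (mon h' \<sigma>') x = mon (h \<circ> h') (\<sigma>' \<circ> \<sigma>) x"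
  proof (cases "x \<in> V")
    case True
    have "\<sigma> i \<in> {1..m}" if "i \<in> {1..m}" for i
      using permutes_in_image[OF assms(2)] that by metis
    then show ?thesis
      using True mon_in[OF assms(1,3) True] mon_apply[OF True]
      unfolding mon_def by (auto simp: compose_eq restrict_def fun_eq_iff)
  qed (simp add: mon_def compose_def)
qed

lemma mon_id: "mon id id = (\<lambda>x\<in>V. x)"
  unfolding mon_def
  by (auto simp: hamming_vertices_def PiE_iff fun_eq_iff restrict_def extensional_def)

lemma mon_inverse:
  assumes "h permutes Q" "\<sigma> permutes {1..m}"
  shows "compose V (mon (inv_into UNIV h) (inv_into UNIV \<sigma>)) (mon h \<sigma>) = (\<lambda>x\<in>V. x)"
    and "compose V (mon h \<sigma>) (mon (inv_into UNIV h) (inv_into UNIV \<sigma>)) = (\<lambda>x\<in>V. x)"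
  using assms by (simp_all add: mon_compose permutes_inv permutes_inv_o mon_id)

lemma mon_Bij:
  assumes "h permutes Q" "\<sigma> permutes {1..m}"
  shows "mon h \<sigma> \<in> Bij V"
proof -
  let ?g = "mon (inv_into UNIV h) (inv_into UNIV \<sigma>)"
  have "?g (mon h \<sigma> x) = x" "mon h \<sigma> (?g x) = x" if "x \<in> V" for x
    using mon_inverse[OF assms] that by (metis compose_eq restrict_apply')+
  moreover have "mon h \<sigma> ` V \<subseteq> V" "?g ` V \<subseteq> V"
    using mon_in[OF assms] mon_in[OF permutes_inv[OF assms(1)] permutes_inv[OF assms(2)]] by blast+
  ultimately have "bij_betw (mon h \<sigma>) V V"
    by (intro bij_betw_byWitness[of _ ?g]) blast+
  then show ?thesis by (simp add: Bij_def mon_def)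
qed

text \<open>Reindexing by \<open>\<sigma>\<close> is a bijection of the positions. With
  \<open>P\<close> a disagreement or a letter condition, this gives the behaviour of distances and
  letter counts.\<close>

lemma mon_fibre_card:
  assumes "\<sigma> permutes {1..m}"
  shows "card {i \<in> {1..m}. P (\<sigma> i)} = card {i \<in> {1..m}. P i}"
proof -
  have *: "\<sigma> i \<in> {1..m} \<longleftrightarrow> i \<in> {1..m}" for i using permutes_in_image[OF assms] .
  have "\<sigma> ` {i \<in> {1..m}. P (\<sigma> i)} = {i \<in> {1..m}. P i}"
  proof (intro equalityI subsetI)
    fix i assume "i \<in> {i \<in> {1..m}. P i}"
    then show "i \<in> \<sigma> ` {i \<in> {1..m}. P (\<sigma> i)}"
      using * permutes_inverses(1)[OF assms, of i]
      by (intro image_eqI[of _ _ "inv_into UNIV \<sigma> i"])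
        (simp, metis (mono_tags, lifting) mem_Collect_eq)
  qed (use * in auto)
  then show ?thesis
    using card_image[OF permutes_inj_on[OF assms]] by metis
qed

lemma mon_dist:
  assumes "h permutes Q" "\<sigma> permutes {1..m}" "x \<in> V" "y \<in> V"
  shows "hamming_dist m (mon h \<sigma> x) (mon h \<sigma> y) = hamming_dist m x y"
proof -
  have "{i \<in> {1..m}. mon h \<sigma> x i \<noteq> mon h \<sigma> y i} = {i \<in> {1..m}. x (\<sigma> i) \<noteq> y (\<sigma> i)}"
    using permutes_inj[OF assms(1)] mon_apply assms by (auto simp: inj_eq)
  then show ?thesis
    unfolding hamming_dist_def using mon_fibre_card[OF assms(2), of "\<lambda>i. x i \<noteq> y i"] by simp
qed

lemma mon_letter_card:
  assumes "h permutes Q" "\<sigma> permutes {1..m}" "x \<in> V"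
  shows "card {i \<in> {1..m}. mon h \<sigma> x i = h a} = card {i \<in> {1..m}. x i = a}"
proof -
  have "{i \<in> {1..m}. mon h \<sigma> x i = h a} = {i \<in> {1..m}. x (\<sigma> i) = a}"
    using permutes_inj[OF assms(1)] mon_apply assms by (auto simp: inj_eq)
  then show ?thesis using mon_fibre_card[OF assms(2), of "\<lambda>i. x i = a"] by simp
qed

lemma mons_subset: "mons \<subseteq> aut_set"
  by (auto simp: mons_def aut_set_def hamming_adj_def mon_dist mon_Bij)

lemma mons_subgroup: "subgroup mons (BijGroup V)"
proof (rule subgroup_BijGroupI)
  show "mons \<subseteq> Bij V" by (auto simp: mons_def mon_Bij)
  show "mons \<noteq> {}" using monsI[OF permutes_id permutes_id] by blast
  show "compose V f g \<in> mons" if "f \<in> mons" "g \<in> mons" for f g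
    using that by (auto simp: mons_def mon_compose) (metis permutes_compose)
  show "(\<lambda>x\<in>V. inv_into V f x) \<in> mons" if f: "f \<in> mons" for f
  proof -
    obtain h \<sigma> where p: "h permutes Q" "\<sigma> permutes {1..m}" and f: "f = mon h \<sigma>"
      using f by (auto simp: mons_def)
    let ?g = "mon (inv_into UNIV h) (inv_into UNIV \<sigma>)"
    have g: "?g \<in> mons" using p by (intro monsI permutes_inv)
    have "inv\<^bsub>BijGroup V\<^esub> f = ?g"
      using mon_Bij[OF p] mon_Bij[OF permutes_inv[OF p(1)] permutes_inv[OF p(2)]] mon_inverse[OF p] f
      by (intro group.inv_equality[OF group_BijGroup]) (auto simp: BijGroup_def)
    then show ?thesis using g f inv_BijGroup[OF mon_Bij[OF p]] by simp
  qed
qed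

section \<open>Diagonal letter permutations and entry permutations\<close>

lemma diag_group_eq: "diag_group m Q = {mon h id | h. h permutes Q}"
  by (simp add: diag_group_def mon_def)

text \<open>The defining formula inverts the permutation and \<open>mon\<close> does not; inversion
  maps the permutations of the positions onto themselves, so both describe the same set.\<close>

lemma entry_perm_group_eq: "entry_perm_group m Q = {mon id \<sigma> | \<sigma>. \<sigma> permutes {1..m}}"
proof -
  have "entry_perm_group m Q = {mon id (inv_into UNIV \<sigma>) | \<sigma>. \<sigma> permutes {1..m}}"
    by (simp add: entry_perm_group_def mon_def)
  also have "\<dots> = {mon id \<sigma> | \<sigma>. \<sigma> permutes {1..m}}"
    by (auto, metis permutes_inv, metis permutes_inv permutes_inv_inv)
  finally show ?thesis .
qed

text \<open>Letter parts and entry parts multiply separately (\<open>mult\<close>), so the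
  requirements become computations with permutations of letters and of positions.\<close>

lemma mons_semidirect:
  "internal_semidirect_product (BijGroup V \<lparr>carrier := mons\<rparr>) (diag_group m Q) (entry_perm_group m Q)"
proof -
  let ?G = "BijGroup V \<lparr>carrier := mons\<rparr>"
  interpret G: group ?G
    using subgroup.subgroup_is_group[OF mons_subgroup group_BijGroup] .
  have mult: "mon h \<sigma> \<otimes>\<^bsub>BijGroup V\<^esub> mon h' \<sigma>' = mon (h \<circ> h') (\<sigma>' \<circ> \<sigma>)"
    if "h permutes Q" "h' permutes Q" "\<sigma> permutes {1..m}" "\<sigma>' permutes {1..m}" for h h' \<sigma> \<sigma>'
    using that mon_Bij by (simp add: BijGroup_def mon_compose)
  have one: "\<one>\<^bsub>BijGroup V\<^esub> = mon id id" by (simp add: BijGroup_def mon_id)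
  have inv: "inv\<^bsub>?G\<^esub> mon h \<sigma> = mon (inv_into UNIV h) (inv_into UNIV \<sigma>)"
    if "h permutes Q" "\<sigma> permutes {1..m}" for h \<sigma>
    using that by (intro G.inv_equality)
      (simp_all add: mult one permutes_inv permutes_inv_o monsI)
  have id: "id permutes Q" "id permutes {1..m}" by (rule permutes_id)+
  have carr: "carrier ?G = mons" by simp
  have diagI: "mon h id \<in> diag_group m Q" if "h permutes Q" for h
    unfolding diag_group_eq using that by blast
  have diagE: "\<exists>h. h permutes Q \<and> a = mon h id" if "a \<in> diag_group m Q" for a
    using that unfolding diag_group_eq by blast
  have entryI: "mon id \<sigma> \<in> entry_perm_group m Q" if "\<sigma> permutes {1..m}" for \<sigma>
    unfolding entry_perm_group_eq using that by blast
  have entryE: "\<exists>\<sigma>. \<sigma> permutes {1..m} \<and> a = mon id \<sigma>" if "a \<in> entry_perm_group m Q" for a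
    using that unfolding entry_perm_group_eq by blast
  have N: "subgroup (diag_group m Q) ?G"
  proof (rule G.subgroupI)
    show "diag_group m Q \<subseteq> carrier ?G"
      unfolding carr diag_group_eq using monsI[OF _ id(2)] by blast
    show "diag_group m Q \<noteq> {}" using diagI[OF id(1)] by blast
  next
    fix a assume "a \<in> diag_group m Q"
    then obtain h where h: "h permutes Q" "a = mon h id" using diagE by blast
    then show "inv\<^bsub>?G\<^esub> a \<in> diag_group m Q"
      using inv[OF h(1) id(2)] diagI[OF permutes_inv[OF h(1)]] by simp
  next
    fix a b assume "a \<in> diag_group m Q" "b \<in> diag_group m Q"
    then obtain h k where h: "h permutes Q" "a = mon h id" and k: "k permutes Q" "b = mon k id"
      using diagE[of a] diagE[of b] by blast
    then show "a \<otimes>\<^bsub>?G\<^esub> b \<in> diag_group m Q"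
      using mult[OF h(1) k(1) id(2) id(2)] diagI[OF permutes_compose[OF k(1) h(1)]] by simp
  qed
  have K: "subgroup (entry_perm_group m Q) ?G"
  proof (rule G.subgroupI)
    show "entry_perm_group m Q \<subseteq> carrier ?G"
      unfolding carr entry_perm_group_eq using monsI[OF id(1)] by blast
    show "entry_perm_group m Q \<noteq> {}" using entryI[OF id(2)] by blast
  next
    fix a assume "a \<in> entry_perm_group m Q"
    then obtain \<sigma> where \<sigma>: "\<sigma> permutes {1..m}" "a = mon id \<sigma>" using entryE by blast
    then show "inv\<^bsub>?G\<^esub> a \<in> entry_perm_group m Q"
      using inv[OF id(1) \<sigma>(1)] entryI[OF permutes_inv[OF \<sigma>(1)]] by simp
  next
    fix a b assume "a \<in> entry_perm_group m Q" "b \<in> entry_perm_group m Q"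
    then obtain \<sigma> \<rho> where \<sigma>: "\<sigma> permutes {1..m}" "a = mon id \<sigma>"
      and \<rho>: "\<rho> permutes {1..m}" "b = mon id \<rho>"
      using entryE[of a] entryE[of b] by blast
    then show "a \<otimes>\<^bsub>?G\<^esub> b \<in> entry_perm_group m Q"
      using mult[OF id(1) id(1) \<sigma>(1) \<rho>(1)] entryI[OF permutes_compose[OF \<sigma>(1) \<rho>(1)]] by simp
  qed
  have "diag_group m Q \<lhd> ?G"
  proof (rule G.normal_invI[OF N])
    fix x n assume "x \<in> carrier ?G" "n \<in> diag_group m Q"
    then obtain h \<sigma> k where *: "h permutes Q" "\<sigma> permutes {1..m}" "k permutes Q"
      and x: "x = mon h \<sigma>" "n = mon k id"
      unfolding carr using monsE diagE by metis
    have inv_perm: "inv_into UNIV h permutes Q" "inv_into UNIV \<sigma> permutes {1..m}"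
      using * by (simp_all only: permutes_inv)
    have "x \<otimes>\<^bsub>?G\<^esub> n \<otimes>\<^bsub>?G\<^esub> inv\<^bsub>?G\<^esub> x =
        mon ((h \<circ> k) \<circ> inv_into UNIV h) (inv_into UNIV \<sigma> \<circ> (id \<circ> \<sigma>))"
      unfolding x inv[OF *(1,2)]
      using mult[OF *(1,3,2) id(2)]
        mult[OF permutes_compose[OF *(3,1)] inv_perm(1) permutes_compose[OF *(2) id(2)] inv_perm(2)]
      by simp
    \<comment> \<open>The entry parts cancel, leaving a conjugate of \<open>k\<close>.\<close>
    also have "\<dots> = mon (h \<circ> k \<circ> inv_into UNIV h) id"
      by (simp only: id_comp permutes_inv_o[OF *(2)])
    finally show "x \<otimes>\<^bsub>?G\<^esub> n \<otimes>\<^bsub>?G\<^esub> inv\<^bsub>?G\<^esub> x \<in> diag_group m Q"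
      using * inv_perm by (simp only: diagI permutes_compose)
  qed
  moreover
  have "diag_group m Q \<inter> entry_perm_group m Q \<subseteq> {mon id id}"
  proof
    fix g assume "g \<in> diag_group m Q \<inter> entry_perm_group m Q"
    then obtain h \<sigma> where h: "h permutes Q" "g = mon h id"
      and \<sigma>: "\<sigma> permutes {1..m}" "g = mon id \<sigma>"
      using diagE[of g] entryE[of g] by blast
    \<comment> \<open>Entry permutations fix constant words, so the constant word of letter
      \<open>a\<close> tests \<open>h\<close> at \<open>a\<close>.\<close>
    have "h a = a" for a
    proof (cases "a \<in> Q")
      case True
      then have c: "(\<lambda>i\<in>{1..m}. a) \<in> V" by (auto simp: hamming_vertices_def)
      have 1: "1 \<in> {1..m}" using m_ge by simp
      have "\<sigma> 1 \<in> {1..m}" using permutes_in_image[OF \<sigma>(1)] 1 by blast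
      then have "mon id \<sigma> (\<lambda>i\<in>{1..m}. a) 1 = a" using mon_apply[OF c 1, of id \<sigma>] by simp
      moreover have "mon h id (\<lambda>i\<in>{1..m}. a) 1 = h a" using mon_apply[OF c 1, of h id] 1 by simp
      ultimately show ?thesis using h(2) \<sigma>(2) by simp
    qed (use permutes_not_in[OF h(1)] in simp)
    then have "h = id" by auto
    with h show "g \<in> {mon id id}" by simp
  qed
  then have "diag_group m Q \<inter> entry_perm_group m Q = {mon id id}"
    using diagI[OF id(1)] entryI[OF id(2)] by blast
  then have "diag_group m Q \<inter> entry_perm_group m Q = {\<one>\<^bsub>?G\<^esub>}"
    using one by simp
  moreover have "diag_group m Q <#>\<^bsub>?G\<^esub> entry_perm_group m Q = carrier ?G"
  proof (intro equalityI subsetI)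
    fix g assume "g \<in> diag_group m Q <#>\<^bsub>?G\<^esub> entry_perm_group m Q"
    then obtain n k where "n \<in> diag_group m Q" "k \<in> entry_perm_group m Q" "g = n \<otimes>\<^bsub>?G\<^esub> k"
      by (auto simp: set_mult_def)
    then show "g \<in> carrier ?G"
      using G.m_closed[OF subgroup.mem_carrier[OF N] subgroup.mem_carrier[OF K]] by blast
  next
    fix g assume "g \<in> carrier ?G"
    then obtain h \<sigma> where *: "h permutes Q" "\<sigma> permutes {1..m}" and g: "g = mon h \<sigma>"
      unfolding carr by (rule monsE)
    have "g = mon h id \<otimes>\<^bsub>?G\<^esub> mon id \<sigma>"
      unfolding g using mult[OF *(1) id(1) id(2) *(2)] by simp
    with diagI[OF *(1)] entryI[OF *(2)] show "g \<in> diag_group m Q <#>\<^bsub>?G\<^esub> entry_perm_group m Q"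
      unfolding set_mult_def by blast
  qed
  ultimately show ?thesis using K unfolding internal_semidirect_product_def by blast
qed

declare One_nat_def [simp del] atLeastAtMost_iff [simp del]

abbreviation cnt :: "(nat \<Rightarrow> 'a) \<Rightarrow> 'a \<Rightarrow> nat" where
  "cnt x a \<equiv> card {i \<in> {1..m}. x i = a}"

subsection \<open>Criteria for codes\<close>

text \<open>Closure is enough to demand: an injective self-map of a finite set is onto, so
  \<open>mons_image\<close> turns it into setwise stability.\<close>

definition invariant :: "(nat \<Rightarrow> 'a) set \<Rightarrow> bool" where
  "invariant C \<longleftrightarrow> C \<subseteq> V \<and> (\<forall>g \<in> mons. \<forall>x \<in> C. g x \<in> C)"

definition transitive_on :: "(nat \<Rightarrow> 'a) set \<Rightarrow> bool" where
  "transitive_on A \<longleftrightarrow> (\<forall>x \<in> A. \<forall>y \<in> A. \<exists>g \<in> mons. g x = y)"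

text \<open>The pair \<open>(\<tau>, h)\<close> encodes the automorphism that moves the entry in position \<open>i\<close> to position
  \<open>\<tau> i\<close> after applying \<open>h i\<close> to it.\<close>

definition preserving :: "(nat \<Rightarrow> 'a) set \<Rightarrow> (nat \<Rightarrow> nat) \<Rightarrow> (nat \<Rightarrow> 'a \<Rightarrow> 'a) \<Rightarrow> bool" where
  "preserving C \<tau> h \<longleftrightarrow> bij_betw \<tau> {1..m} {1..m} \<and>
     (\<forall>i \<in> {1..m}. h i ` Q \<subseteq> Q \<and> inj_on (h i) Q) \<and>
     (\<forall>x \<in> C. \<exists>y \<in> C. \<forall>i \<in> {1..m}. y (\<tau> i) = h i (x i))"

text \<open>All entry permutations stabilise the codes, so \<open>\<tau>\<close> stays free;
  agreement of the letter permutations is what separates S_q^m from its diagonal.\<close>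

definition rigid :: "(nat \<Rightarrow> 'a) set \<Rightarrow> bool" where
  "rigid C \<longleftrightarrow> (\<forall>\<tau> h. preserving C \<tau> h \<longrightarrow>
     (\<forall>i \<in> {1..m}. \<forall>j \<in> {1..m}. i \<noteq> j \<longrightarrow> (\<forall>a \<in> Q. h i a = h j a)))"

lemma preservingD:
  assumes "preserving C \<tau> h"
  shows "bij_betw \<tau> {1..m} {1..m}"
    and "i \<in> {1..m} \<Longrightarrow> h i ` Q \<subseteq> Q"
    and "i \<in> {1..m} \<Longrightarrow> inj_on (h i) Q"
    and "x \<in> C \<Longrightarrow> \<exists>y \<in> C. \<forall>i \<in> {1..m}. y (\<tau> i) = h i (x i)"
  using assms unfolding preserving_def by simp_all

lemma invariantD: "invariant C \<Longrightarrow> x \<in> C \<Longrightarrow> h permutes Q \<Longrightarrow> \<sigma> permutes {1..m} \<Longrightarrow> mon h \<sigma> x \<in> C"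
  using monsI unfolding invariant_def by blast

lemma invariant_sub: "invariant C \<Longrightarrow> x \<in> C \<Longrightarrow> x \<in> V"
  unfolding invariant_def by blast

lemma invariantI:
  assumes "C \<subseteq> V"
    and "\<And>h \<sigma> x. h permutes Q \<Longrightarrow> \<sigma> permutes {1..m} \<Longrightarrow> x \<in> C \<Longrightarrow> mon h \<sigma> x \<in> C"
  shows "invariant C"
  using assms unfolding invariant_def by (auto elim!: monsE)

section \<open>From rigidity to the stabiliser\<close>

lemma mons_image:
  assumes "invariant C" "g \<in> mons"
  shows "g ` C = C"
proof -
  have "finite C" using assms finite_V unfolding invariant_def by (meson finite_subset)
  moreover have "g ` C \<subseteq> C" using assms unfolding invariant_def by blast
  moreover have "inj_on g C"
    using assms mons_subset unfolding invariant_def aut_set_def Bij_def bij_betw_def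
    by (blast intro: inj_on_subset)
  ultimately show ?thesis by (rule endo_inj_surj)
qed

lemma aut_in_mons:
  assumes "invariant C" "rigid C" and g: "g \<in> aut_set" "g ` C = C"
  shows "g \<in> mons"
proof -
  have bij: "bij_betw g V V" and ext: "g \<in> extensional V"
    using g by (auto simp: aut_set_def Bij_def)
  have adj: "hamming_adj m (g x) (g y) \<longleftrightarrow> hamming_adj m x y" if "x \<in> V" "y \<in> V" for x y
    using g that by (auto simp: aut_set_def)
  obtain \<tau> h where \<tau>: "bij_betw \<tau> {1..m} {1..m}"
    and h: "\<And>i. i \<in> {1..m} \<Longrightarrow> h i ` Q \<subseteq> Q" "\<And>i. i \<in> {1..m} \<Longrightarrow> inj_on (h i) Q"
    and gx: "\<And>x i. x \<in> V \<Longrightarrow> i \<in> {1..m} \<Longrightarrow> g x (\<tau> i) = h i (x i)"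
    using aut_decomposition[OF bij adj] by blast
  have "\<exists>y \<in> C. \<forall>i \<in> {1..m}. y (\<tau> i) = h i (x i)" if "x \<in> C" for x
    using g(2) that gx invariant_sub[OF assms(1) that] by (intro bexI[of _ "g x"]) auto
  then have "preserving C \<tau> h" using \<tau> h unfolding preserving_def by blast
  moreover have 1: "1 \<in> {1..m}" using m_ge by (simp add: atLeastAtMost_iff)
  ultimately have same: "h i a = h 1 a" if "i \<in> {1..m}" "a \<in> Q" for i a
    using \<open>rigid C\<close> that 1 unfolding rigid_def by (cases "i = 1") auto
  \<comment> \<open>By rigidity \<open>h 1\<close> stands for every \<open>h i\<close>; it is
    extended by the identity outside \<open>Q\<close>, as \<open>\<tau>\<close> is below outside the
    positions, to become a permutation.\<close>
  define k where "k a = (if a \<in> Q then h 1 a else a)" for a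
  have "bij_betw (h 1) Q Q"
    using h[OF 1] endo_inj_surj[OF finite_Q] by (simp add: bij_betw_def)
  then have "bij_betw k Q Q" by (rule bij_betw_cong[THEN iffD1, rotated]) (simp add: k_def)
  then have k: "k permutes Q" by (rule bij_imp_permutes) (simp add: k_def)
  define \<rho> where "\<rho> i = (if i \<in> {1..m} then \<tau> i else i)" for i
  have "bij_betw \<rho> {1..m} {1..m}"
    using \<tau> by (rule bij_betw_cong[THEN iffD1, rotated]) (simp add: \<rho>_def)
  then have \<rho>: "\<rho> permutes {1..m}" by (rule bij_imp_permutes) (simp add: \<rho>_def)
  \<comment> \<open>\<open>mon\<close> fetches the entry for position \<open>i\<close> from its
    permutation at \<open>i\<close>, whereas \<open>g\<close> sends the entry at \<open>i\<close> to
    \<open>\<tau> i\<close>; hence the inverse.\<close>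
  let ?\<sigma> = "inv_into UNIV \<rho>"
  have \<sigma>: "?\<sigma> permutes {1..m}" using \<rho> by (rule permutes_inv)
  have "g = mon k ?\<sigma>"
  proof (rule extensionalityI[OF ext])
    show "mon k ?\<sigma> \<in> extensional V" by (simp add: mon_def)
    fix x assume x: "x \<in> V"
    have gV: "g x \<in> V" using bij x by (auto simp: bij_betw_def)
    show "g x = mon k ?\<sigma> x"
    proof (rule vertex_eqI[OF gV mon_in[OF k \<sigma> x]])
      fix i assume i: "i \<in> {1..m}"
      have si: "?\<sigma> i \<in> {1..m}" using permutes_in_image[OF \<sigma>] i by blast
      have "\<tau> (?\<sigma> i) = i" using permutes_inverses(1)[OF \<rho>, of i] si by (simp add: \<rho>_def)
      then have "g x i = h (?\<sigma> i) (x (?\<sigma> i))" using gx[OF x si] by simp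
      also have "\<dots> = k (x (?\<sigma> i))" using same[OF si] vertex_in[OF x si] by (simp add: k_def)
      finally show "g x i = mon k ?\<sigma> x i" using mon_apply[OF x i] by simp
    qed
  qed
  then show ?thesis using monsI[OF k \<sigma>] by simp
qed

lemma code_aut_eq:
  assumes "invariant C" "rigid C"
  shows "code_aut m Q C = BijGroup V \<lparr>carrier := mons\<rparr>"
proof -
  have "stabilizer (hamming_aut m Q) (\<lambda>g S. g ` S) C = mons"
    using aut_in_mons[OF assms] mons_image[OF assms(1)] mons_subset
    by (auto simp: stabilizer_def hamming_aut_eq)
  then show ?thesis by (simp add: code_aut_def hamming_aut_eq)
qed

section \<open>Orbits of a code and of its neighbours\<close>

lemma orbitsI:
  assumes "invariant A" "A \<noteq> {}" "transitive_on A"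
  shows "A \<in> orbits (hamming_aut m Q \<lparr>carrier := mons\<rparr>) V (\<lambda>g. g)"
proof -
  obtain x where x: "x \<in> A" using assms(2) by blast
  have "orbit (hamming_aut m Q \<lparr>carrier := mons\<rparr>) (\<lambda>g. g) x = A"
  proof (intro equalityI subsetI)
    fix y assume "y \<in> orbit (hamming_aut m Q \<lparr>carrier := mons\<rparr>) (\<lambda>g. g) x"
    then show "y \<in> A" using assms(1) x by (auto simp: orbit_def invariant_def)
  next
    fix y assume "y \<in> A"
    then obtain g where "g \<in> mons" "g x = y" using assms(3) x unfolding transitive_on_def by blast
    then show "y \<in> orbit (hamming_aut m Q \<lparr>carrier := mons\<rparr>) (\<lambda>g. g) x"
      by (auto simp: orbit_def)
  qed
  then show ?thesis using invariant_sub[OF assms(1) x] unfolding orbits_def by blast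
qed

lemma code_neighbours_invariant:
  assumes "invariant C"
  shows "invariant (code_neighbours m Q C)"
proof -
  have "g x \<in> code_neighbours m Q C" if g: "g \<in> mons" and x: "x \<in> code_neighbours m Q C" for g x
  proof -
    obtain y where y: "y \<in> C" "hamming_adj m x y" and xV: "x \<in> V" "x \<notin> C"
      using x unfolding code_neighbours_def by blast
    have yV: "y \<in> V" using invariant_sub[OF assms y(1)] .
    have bij: "bij_betw g V V" and adj: "hamming_adj m (g x) (g y)"
      using subsetD[OF mons_subset g] xV(1) yV y(2) by (auto simp: aut_set_def Bij_def)
    have "g x \<in> V" using bij xV(1) by (auto simp: bij_betw_def)
    moreover have "g y \<in> C" using assms g y unfolding invariant_def by blast
    \<comment> \<open>\<open>g\<close> is injective and maps C onto C, so no word outside C is sent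
      into it.\<close>
    moreover have "g x \<notin> C"
    proof
      assume "g x \<in> C"
      then obtain z where z: "z \<in> C" "g x = g z" using mons_image[OF assms g] by blast
      then have "x = z" using bij xV(1) invariant_sub[OF assms z(1)]
        unfolding bij_betw_def by (meson inj_onD)
      with z xV show False by simp
    qed
    ultimately show ?thesis using adj unfolding code_neighbours_def by blast
  qed
  moreover have "code_neighbours m Q C \<subseteq> V" unfolding code_neighbours_def by blast
  ultimately show ?thesis unfolding invariant_def by blast
qed

text \<open>Nonemptiness appears because orbits are nonempty, whereas \<open>transitive_on\<close>
  holds vacuously of the empty set.\<close>

lemma code_criterion:
  assumes "invariant C" "rigid C" "C \<noteq> {}" "transitive_on C"
    and "code_neighbours m Q C \<noteq> {}" "transitive_on (code_neighbours m Q C)"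
  shows "neighbour_transitive m Q C \<and>
    internal_semidirect_product (code_aut m Q C) (diag_group m Q) (entry_perm_group m Q)"
proof
  have "subgroup mons (hamming_aut m Q)"
    unfolding hamming_aut_eq
    by (rule group.subgroup_incl[OF group_BijGroup mons_subgroup aut_set_subgroup mons_subset])
  then show "neighbour_transitive m Q C"
    using orbitsI[OF assms(1,3,4)] orbitsI[OF code_neighbours_invariant[OF assms(1)] assms(5,6)]
    unfolding neighbour_transitive_def by blast
  show "internal_semidirect_product (code_aut m Q C) (diag_group m Q) (entry_perm_group m Q)"
    unfolding code_aut_eq[OF assms(1,2)] by (rule mons_semidirect)
qed

section \<open>Minimum distance and existence of neighbours\<close>

lemma min_distance_eqI:
  assumes "C \<subseteq> V" and "x \<in> C" "y \<in> C" "x \<noteq> y" "hamming_dist m x y = d"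
    and "\<And>x y. x \<in> C \<Longrightarrow> y \<in> C \<Longrightarrow> x \<noteq> y \<Longrightarrow> d \<le> hamming_dist m x y"
  shows "min_distance m C = d"
  unfolding min_distance_def
proof (rule Min_eqI)
  have "finite C" using assms(1) finite_V finite_subset by blast
  then have "finite ((\<lambda>(x, y). hamming_dist m x y) ` (C \<times> C))" by simp
  then show "finite {hamming_dist m x y |x y. x \<in> C \<and> y \<in> C \<and> x \<noteq> y}"
    by (rule rev_finite_subset) auto
qed (use assms in blast)+

lemma hamming_dist_eq: "hamming_dist m x y = card (diffs x y)"
  by (simp add: hamming_dist_def diffs_def)

lemma hamming_dist_pos: "x \<in> V \<Longrightarrow> y \<in> V \<Longrightarrow> x \<noteq> y \<Longrightarrow> 1 \<le> hamming_dist m x y"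
  using diffs_empty_iff[of x y] card_gt_0_iff[of "diffs x y"] finite_subset[OF diffs_subset[of x y]]
  by (simp add: hamming_dist_eq)

lemma hamming_dist_upd:
  fixes x :: "nat \<Rightarrow> 'a"
  shows "i \<in> {1..m} \<Longrightarrow> a \<noteq> x i \<Longrightarrow> hamming_dist m x (x(i := a)) = 1"
  by (simp add: hamming_dist_eq diffs_upd)

lemma code_neighboursI:
  assumes "C \<subseteq> V" "x \<in> C" "i \<in> {1..m}" "a \<in> Q" "x(i := a) \<notin> C"
  shows "code_neighbours m Q C \<noteq> {}"
proof -
  have "a \<noteq> x i" using assms(2,5) by auto
  then have "hamming_adj m (x(i := a)) x"
    using diffs_upd[OF assms(3)] unfolding adj_iff_diffs diffs_sym[of _ x] by blast
  then have "x(i := a) \<in> code_neighbours m Q C"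
    using assms vertex_upd unfolding code_neighbours_def by blast
  then show ?thesis by blast
qed

lemma code_neighboursE:
  assumes "x \<in> code_neighbours m Q C"
  obtains y i where "x \<in> V" "x \<notin> C" "y \<in> C" "i \<in> {1..m}" "diffs x y = {i}"
proof -
  obtain y where y: "x \<in> V" "x \<notin> C" "y \<in> C" "hamming_adj m x y"
    using assms unfolding code_neighbours_def by blast
  then obtain i where "diffs x y = {i}" unfolding adj_iff_diffs by blast
  moreover from this have "i \<in> {1..m}" using diffs_subset[of x y] by blast
  ultimately show thesis using y that by blast
qed

text \<open>Here the entry permutation is given and the letter permutation is found: equal
  partitions of the positions match the letters of the two words.\<close>

lemma same_kernel_imp_mons:
  assumes x: "x \<in> V" and y: "y \<in> V" and \<sigma>: "\<sigma> permutes {1..m}"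
    and ker: "\<And>i j. i \<in> {1..m} \<Longrightarrow> j \<in> {1..m} \<Longrightarrow> x (\<sigma> i) = x (\<sigma> j) \<longleftrightarrow> y i = y j"
  shows "\<exists>g \<in> mons. g x = y"
proof -
  define z where "z i = x (\<sigma> i)" for i
  \<comment> \<open>\<open>f\<close> translates the letter of \<open>x\<close> at
    \<open>\<sigma> i\<close> into the letter of \<open>y\<close> at \<open>i\<close>. Left to
    right, \<open>ker\<close> makes it independent of the chosen position; right to left, it makes
    it injective.\<close>
  define f where "f b = y (inv_into {1..m} z b)" for b
  have f: "f (z i) = y i" if "i \<in> {1..m}" for i
  proof -
    have zi: "z i \<in> z ` {1..m}" using that by (rule imageI)
    show ?thesis
      using ker[OF inv_into_into[OF zi] that] f_inv_into_f[OF zi] unfolding f_def z_def by simp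
  qed
  have "z ` {1..m} \<subseteq> Q"
    by (auto simp: z_def vertex_in[OF x] permutes_in_image[OF \<sigma>])
  moreover have "inj_on f (z ` {1..m})"
  proof (rule inj_onI)
    fix b c assume "b \<in> z ` {1..m}" "c \<in> z ` {1..m}" and eq: "f b = f c"
    then obtain i j where "i \<in> {1..m}" "j \<in> {1..m}" "b = z i" "c = z j" by blast
    with eq f ker show "b = c" by (simp add: z_def)
  qed
  moreover have "f ` z ` {1..m} \<subseteq> Q"
    unfolding image_image using vertex_in[OF y] by (intro image_subsetI) (simp add: f)
  ultimately have "\<exists>h. h permutes Q \<and> (\<forall>b \<in> z ` {1..m}. h b = f b)"
    by (rule extend_to_permutation[OF finite_Q])
  then obtain h where h: "h permutes Q" "\<forall>b \<in> z ` {1..m}. h b = f b" by blast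
  have "mon h \<sigma> x = y"
  proof (rule vertex_eqI[OF mon_in[OF h(1) \<sigma> x] y])
    fix i assume i: "i \<in> {1..m}"
    then show "mon h \<sigma> x i = y i" using mon_apply[OF x i] h(2) f[OF i] by (simp add: z_def)
  qed
  with monsI[OF h(1) \<sigma>] show ?thesis by blast
qed

text \<open>In contrast to \<open>same_kernel_imp_mons\<close>, the letter permutation is given and
  the entry permutation is found, by matching fibres of equal size.\<close>

lemma same_counts_imp_mons:
  assumes x: "x \<in> V" and y: "y \<in> V" and h: "h permutes Q"
    and cnt: "\<And>a. a \<in> Q \<Longrightarrow> cnt y (h a) = cnt x a"
  shows "\<exists>g \<in> mons. g x = y"
proof -
  \<comment> \<open>The matching asks for all values \<open>b\<close>, also those outside
    \<open>Q\<close>, whose fibres are empty.\<close>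
  have "card {i \<in> {1..m}. y i = b} = card {i \<in> {1..m}. h (x i) = b}" for b
  proof (cases "b \<in> Q")
    case True
    then obtain a where a: "a \<in> Q" "b = h a" using permutes_image[OF h] by blast
    have "{i \<in> {1..m}. h (x i) = b} = {i \<in> {1..m}. x i = a}"
      using permutes_inj[OF h] a by (auto simp: inj_eq)
    with cnt[OF a(1)] a show ?thesis by simp
  next
    case False
    moreover have "y i \<in> Q" "h (x i) \<in> Q" if "i \<in> {1..m}" for i
      using vertex_in[OF x that] vertex_in[OF y that] by (simp_all add: permutes_in_image[OF h])
    ultimately have "{i \<in> {1..m}. y i = b} = {}" "{i \<in> {1..m}. h (x i) = b} = {}" by blast+
    then show ?thesis by (simp only:)
  qed
  then have "\<exists>\<sigma>. \<sigma> permutes {1..m} \<and> (\<forall>i \<in> {1..m}. y i = h (x (\<sigma> i)))"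
    by (rule equal_fibre_cards_imp_permutes[of "{1..m}" y "\<lambda>i. h (x i)", OF finite_atLeastAtMost])
  then obtain \<sigma> where \<sigma>: "\<sigma> permutes {1..m}" "\<forall>i \<in> {1..m}. y i = h (x (\<sigma> i))" by blast
  have "mon h \<sigma> x = y"
    using \<sigma>(2) mon_apply[OF x] by (intro vertex_eqI[OF mon_in[OF h \<sigma>(1) x] y]) simp
  with monsI[OF h \<sigma>(1)] show ?thesis by blast
qed

text \<open>Both symmetric groups are 2-transitive: one moves the two positions, the other recolours
  their letters. Codewords obtained in this way test whether \<open>h i\<close> and
  \<open>h j\<close> agree.\<close>

lemma invariant_prescribe_two:
  assumes C: "invariant C" and x: "x \<in> C" "r \<in> {1..m}" "s \<in> {1..m}" "x r \<noteq> x s"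
    and ij: "i \<in> {1..m}" "j \<in> {1..m}" "i \<noteq> j" and ab: "a \<in> Q" "b \<in> Q" "a \<noteq> b"
  obtains y where "y \<in> C" "y i = a" "y j = b"
proof -
  have xV: "x \<in> V" using invariant_sub[OF C x(1)] .
  have "r \<noteq> s" using x by auto
  then obtain \<sigma> where \<sigma>: "\<sigma> permutes {1..m}" "\<sigma> i = r" "\<sigma> j = s"
    using two_points_permutation[of "{1..m}" i j r s] x ij by blast
  obtain h where h: "h permutes Q" "h (x r) = a" "h (x s) = b"
    using two_points_permutation[OF finite_Q vertex_in[OF xV x(2)] vertex_in[OF xV x(3)] x(4) ab]
    by blast
  show thesis
  proof
    show "mon h \<sigma> x \<in> C" by (rule invariantD[OF C x(1) h(1) \<sigma>(1)])
    show "mon h \<sigma> x i = a" "mon h \<sigma> x j = b"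
      using mon_apply[OF xV] ij \<sigma> h by auto
  qed
qed

text \<open>Take a codeword with letters \<open>a\<close> and \<open>b\<close> at \<open>i\<close> and \<open>j\<close>. Swapping these two entries
  removes the letter \<open>h i a\<close> from the affected positions of the image and introduces none.\<close>

lemma preserving_count_jump:
  assumes C: "invariant C" and x: "x \<in> C" "r \<in> {1..m}" "s \<in> {1..m}" "x r \<noteq> x s"
    and pres: "preserving C \<tau> h" and ij: "i \<in> {1..m}" "j \<in> {1..m}"
    and ab: "a \<in> Q" "b \<in> Q" "a \<noteq> b" and neq: "h i a \<noteq> h j a"
  obtains y y' where "y \<in> C" "y' \<in> C"
    "cnt y (h i a) = cnt y' (h i a) + (if h j b = h i a then 2 else 1)"
proof -
  have "i \<noteq> j" using neq by auto
  obtain z where z: "z \<in> C" "z i = a" "z j = b"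
    using invariant_prescribe_two[OF C x ij \<open>i \<noteq> j\<close> ab] .
  define z' where "z' = mon id (transpose i j) z"
  have tr: "transpose i j permutes {1..m}" using ij by (intro permutes_swap_id)
  have z': "z' \<in> C" unfolding z'_def by (rule invariantD[OF C z(1) permutes_id tr])
  have z'k: "z' k = z (transpose i j k)" if "k \<in> {1..m}" for k
    unfolding z'_def using mon_apply[OF invariant_sub[OF C z(1)] that] by simp
  obtain y where y: "y \<in> C" "\<forall>k \<in> {1..m}. y (\<tau> k) = h k (z k)"
    using preservingD(4)[OF pres z(1)] by blast
  obtain y' where y': "y' \<in> C" "\<forall>k \<in> {1..m}. y' (\<tau> k) = h k (z' k)"
    using preservingD(4)[OF pres z'] by blast
  have \<tau>: "\<tau> ` {1..m} = {1..m}" "inj_on \<tau> {1..m}"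
    using preservingD(1)[OF pres] by (simp_all add: bij_betw_def)
  have inj: "inj_on (h i) Q" by (rule preservingD(3)[OF pres ij(1)])
  let ?c = "h i a"
  let ?S = "{k \<in> {1..m}. h k (z k) = ?c}" and ?S' = "{k \<in> {1..m}. h k (z' k) = ?c}"
  \<comment> \<open>As \<open>\<tau>\<close> is a bijection of the positions, letters of an image
    may be counted at the positions they come from.\<close>
  have cnt: "cnt w c = card {k \<in> {1..m}. f k = c}"
    if "\<forall>k \<in> {1..m}. w (\<tau> k) = f k" for w c f
  proof -
    have "{l \<in> {1..m}. w l = c} = {l \<in> \<tau> ` {1..m}. w l = c}" by (simp only: \<tau>(1))
    also have "\<dots> = \<tau> ` {k \<in> {1..m}. w (\<tau> k) = c}" by blast
    also have "{k \<in> {1..m}. w (\<tau> k) = c} = {k \<in> {1..m}. f k = c}"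
      using that by (intro Collect_cong conj_cong) simp_all
    finally show ?thesis
      using card_image[OF inj_on_subset[OF \<tau>(2), of "{k \<in> {1..m}. f k = c}"]] by simp
  qed
  have ib: "h i b \<noteq> ?c" using inj_onD[OF inj _ ab(2,1)] ab(3) by auto
  have zz: "z' i = b" "z' j = a" "\<And>k. k \<in> {1..m} \<Longrightarrow> k \<noteq> i \<Longrightarrow> k \<noteq> j \<Longrightarrow> z' k = z k"
    using z(2,3) z'k[OF ij(1)] z'k[OF ij(2)] z'k by simp_all
  have notin: "i \<notin> ?S'" "j \<notin> ?S'" using zz(1,2) ib neq by simp_all
  \<comment> \<open>Before the swap \<open>i\<close> contributes to the count, and \<open>j\<close>
    does so exactly when \<open>h j b = h i a\<close>. After it neither does: \<open>h i b\<close>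
    differs by injectivity and \<open>h j a\<close> by assumption.\<close>
  have S: "?S = insert i (if h j b = ?c then insert j ?S' else ?S')"
  proof (rule Set.set_eqI)
    fix k
    show "k \<in> ?S \<longleftrightarrow> k \<in> insert i (if h j b = ?c then insert j ?S' else ?S')"
      using z(2,3) zz(3)[of k] ij notin \<open>i \<noteq> j\<close> by (cases "k = i"; cases "k = j"; cases "k \<in> {1..m}") simp_all
  qed
  have "card ?S = card ?S' + (if h j b = ?c then 2 else 1)"
    unfolding S using notin \<open>i \<noteq> j\<close> by simp
  then have "cnt y ?c = cnt y' ?c + (if h j b = ?c then 2 else 1)"
    using cnt[OF y(2)] cnt[OF y'(2)] by presburger
  with y(1) y'(1) that show thesis by blast
qed

lemma rigidI:
  assumes "\<And>\<tau> h i j a. preserving C \<tau> h \<Longrightarrow> i \<in> {1..m} \<Longrightarrow> j \<in> {1..m} \<Longrightarrow> i \<noteq> j \<Longrightarrow> a \<in> Q \<Longrightarrow>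
    h i a = h j a"
  shows "rigid C"
  using assms unfolding rigid_def by blast

lemma other_letter:
  obtains b where "b \<in> Q" "b \<noteq> a"
proof -
  have "\<not> Q \<subseteq> {a}" using card_Q card_mono[of "{a}" Q] by auto
  then show thesis using that by blast
qed

lemma cnt_diff_singleton:
  assumes "diffs x y = {i}"
  shows "cnt x (x i) = cnt y (x i) + 1"
    and "c \<noteq> x i \<Longrightarrow> c \<noteq> y i \<Longrightarrow> cnt x c = cnt y c"
    and "cnt x c \<le> cnt y c + 1"
proof -
  have i: "i \<in> {1..m}" "x i \<noteq> y i" using assms unfolding diffs_def by blast+
  have eq: "x k = y k" if "k \<in> {1..m}" "k \<noteq> i" for k using diffs_singletonD[OF assms that] .
  have "{k \<in> {1..m}. x k = x i} = insert i {k \<in> {1..m}. y k = x i}"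
  proof (rule Set.set_eqI)
    fix k
    show "k \<in> {k \<in> {1..m}. x k = x i} \<longleftrightarrow> k \<in> insert i {k \<in> {1..m}. y k = x i}"
      using eq[of k] i by (cases "k = i") auto
  qed
  then show "cnt x (x i) = cnt y (x i) + 1" using i by simp
  show "cnt x c = cnt y c" if c: "c \<noteq> x i" "c \<noteq> y i"
  proof -
    have "{k \<in> {1..m}. x k = c} = {k \<in> {1..m}. y k = c}"
      using eq c by (intro Collect_cong) metis
    then show ?thesis by simp
  qed
  have "{k \<in> {1..m}. x k = c} \<subseteq> insert i {k \<in> {1..m}. y k = c}" using eq by auto
  then have "cnt x c \<le> card (insert i {k \<in> {1..m}. y k = c})" by (intro card_mono) auto
  also have "\<dots> \<le> cnt y c + 1" using card_insert_le_m1[of "cnt y c + 1" "{k \<in> {1..m}. y k = c}" i] by simp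
  finally show "cnt x c \<le> cnt y c + 1" .
qed

lemma one_in: "1 \<in> {1..m}" and two_in: "2 \<in> {1..m}"
  using m_ge by (simp_all add: atLeastAtMost_iff)

lemma mon_permutes_in: "\<sigma> permutes {1..m} \<Longrightarrow> i \<in> {1..m} \<Longrightarrow> \<sigma> i \<in> {1..m}"
  by (simp only: permutes_in_image)

subsection \<open>The repetition code\<close>

lemma const_vertex: "a \<in> Q \<Longrightarrow> (\<lambda>i\<in>{1..m}. a) \<in> V"
  by (simp add: hamming_vertices_def)

lemma rep_codeE:
  assumes "x \<in> rep_code m Q"
  obtains a where "a \<in> Q" "\<forall>i \<in> {1..m}. x i = a" "x = (\<lambda>i\<in>{1..m}. a)"
proof -
  obtain a where "a \<in> Q" "x = (\<lambda>i\<in>{1..m}. a)" using assms unfolding rep_code_def by blast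
  with that show thesis by simp
qed

lemma rep_sub: "rep_code m Q \<subseteq> V"
  using const_vertex by (auto simp: rep_code_def)

lemma rep_codeI: "a \<in> Q \<Longrightarrow> (\<lambda>i\<in>{1..m}. a) \<in> rep_code m Q"
  unfolding rep_code_def by blast

lemma rep_invariant: "invariant (rep_code m Q)"
proof (rule invariantI[OF rep_sub])
  fix h \<sigma> x assume h: "h permutes Q" and \<sigma>: "\<sigma> permutes {1..m}" and "x \<in> rep_code m Q"
  then have xV: "x \<in> V" using rep_sub by blast
  obtain a where a: "a \<in> Q" and x: "\<forall>i \<in> {1..m}. x i = a"
    using \<open>x \<in> rep_code m Q\<close> by (rule rep_codeE)
  have ha: "h a \<in> Q" using a by (simp only: permutes_in_image[OF h])
  have "mon h \<sigma> x = (\<lambda>i\<in>{1..m}. h a)"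
    by (rule vertex_eqI[OF mon_in[OF h \<sigma> xV] const_vertex[OF ha]])
      (simp add: mon_apply[OF xV] x mon_permutes_in[OF \<sigma>])
  then show "mon h \<sigma> x \<in> rep_code m Q" using rep_codeI[OF ha] by simp
qed

text \<open>The constant word of letter \<open>a\<close> has an image carrying \<open>h i a\<close>
  at \<open>\<tau> i\<close>; as this image is constant too, the values \<open>h i a\<close>
  agree.\<close>

lemma rep_rigid: "rigid (rep_code m Q)"
proof (rule rigidI)
  fix \<tau> h i j a
  assume pres: "preserving (rep_code m Q) \<tau> h" and ij: "i \<in> {1..m}" "j \<in> {1..m}" and a: "a \<in> Q"
  note \<tau> = preservingD(1)[OF pres]
  obtain y where y: "y \<in> rep_code m Q" "\<forall>k \<in> {1..m}. y (\<tau> k) = h k ((\<lambda>i\<in>{1..m}. a) k)"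
    using preservingD(4)[OF pres rep_codeI[OF a]] by blast
  obtain b where "\<forall>k \<in> {1..m}. y k = b" using y(1) by (rule rep_codeE)
  then have "y (\<tau> i) = y (\<tau> j)" using bij_betwE[OF \<tau>] ij by simp
  then show "h i a = h j a" using y(2) ij by simp
qed

lemma rep_transitive: "transitive_on (rep_code m Q)"
  unfolding transitive_on_def
proof (intro ballI)
  fix x y assume x: "x \<in> rep_code m Q" and y: "y \<in> rep_code m Q"
  obtain a where a: "\<forall>i \<in> {1..m}. x i = a" using x by (rule rep_codeE)
  obtain b where b: "\<forall>i \<in> {1..m}. y i = b" using y by (rule rep_codeE)
  show "\<exists>g \<in> mons. g x = y"
    by (rule same_kernel_imp_mons[OF subsetD[OF rep_sub x] subsetD[OF rep_sub y] permutes_id])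
      (simp add: a b)
qed

text \<open>Only one entry deviates from a constant word. Recording the partition and not the
  letters prepares \<open>same_kernel_imp_mons\<close>; for m = 2 either position can serve as
  \<open>i\<close>.\<close>

lemma rep_neighboursE:
  assumes "x \<in> code_neighbours m Q (rep_code m Q)"
  obtains i where "i \<in> {1..m}" "\<forall>k \<in> {1..m}. \<forall>l \<in> {1..m}. x k = x l \<longleftrightarrow> (k = i \<longleftrightarrow> l = i)"
proof -
  obtain y i where y: "y \<in> rep_code m Q" and i: "i \<in> {1..m}" "diffs x y = {i}"
    using assms by (rule code_neighboursE)
  obtain a where a: "\<forall>i \<in> {1..m}. y i = a" using y by (rule rep_codeE)
  have "i \<in> diffs x y" using i by simp
  then have "x i \<noteq> a" using a i(1) by (simp add: diffs_def)
  moreover have "x k = a" if "k \<in> {1..m}" "k \<noteq> i" for k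
    using diffs_singletonD[OF i(2) that] a that(1) by simp
  ultimately have "x k = x l \<longleftrightarrow> (k = i \<longleftrightarrow> l = i)" if "k \<in> {1..m}" "l \<in> {1..m}" for k l
    using that by (cases "k = i"; cases "l = i") simp_all
  then show thesis by (intro that[OF i(1)] ballI)
qed

lemma rep_neighbours_transitive: "transitive_on (code_neighbours m Q (rep_code m Q))"
  unfolding transitive_on_def
proof (intro ballI)
  let ?N = "code_neighbours m Q (rep_code m Q)"
  fix x y assume x: "x \<in> ?N" and y: "y \<in> ?N"
  obtain i where i: "i \<in> {1..m}"
    and xi: "\<forall>k \<in> {1..m}. \<forall>l \<in> {1..m}. x k = x l \<longleftrightarrow> (k = i \<longleftrightarrow> l = i)"
    using x by (rule rep_neighboursE)
  obtain j where j: "j \<in> {1..m}"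
    and yj: "\<forall>k \<in> {1..m}. \<forall>l \<in> {1..m}. y k = y l \<longleftrightarrow> (k = j \<longleftrightarrow> l = j)"
    using y by (rule rep_neighboursE)
  have tr: "transpose i j permutes {1..m}" using i j by (intro permutes_swap_id)
  have V: "x \<in> V" "y \<in> V" using x y by (simp_all add: code_neighbours_def)
  show "\<exists>g \<in> mons. g x = y"
  proof (rule same_kernel_imp_mons[OF V tr])
    fix k l assume kl: "k \<in> {1..m}" "l \<in> {1..m}"
    have "transpose i j k = i \<longleftrightarrow> k = j" for k by (auto simp: transpose_def)
    then show "x (transpose i j k) = x (transpose i j l) \<longleftrightarrow> y k = y l"
      using bspec[OF bspec[OF yj kl(1)] kl(2)]
        bspec[OF bspec[OF xi mon_permutes_in[OF tr kl(1)]] mon_permutes_in[OF tr kl(2)]]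
      by simp
  qed
qed

lemma rep_code_theorem:
  shows "neighbour_transitive m Q (rep_code m Q) \<and>
    internal_semidirect_product (code_aut m Q (rep_code m Q)) (diag_group m Q) (entry_perm_group m Q) \<and>
    min_distance m (rep_code m Q) = m"
proof -
  let ?C = "rep_code m Q"
  obtain a where a: "a \<in> Q" using other_letter by blast
  obtain b where b: "b \<in> Q" "b \<noteq> a" using other_letter by blast
  let ?a = "\<lambda>i\<in>{1..m}. a" and ?b = "\<lambda>i\<in>{1..m}. b"
  have ne: "?C \<noteq> {}" using rep_codeI[OF a] by blast
  have dist: "hamming_dist m x y = m" if x: "x \<in> ?C" and y: "y \<in> ?C" and "x \<noteq> y" for x y
  proof -
    obtain c where c: "x = (\<lambda>i\<in>{1..m}. c)" using x by (rule rep_codeE)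
    obtain d where d: "y = (\<lambda>i\<in>{1..m}. d)" using y by (rule rep_codeE)
    have "c \<noteq> d" using \<open>x \<noteq> y\<close> c d by auto
    then have "{i \<in> {1..m}. x i \<noteq> y i} = {1..m}" unfolding c d by simp
    then show ?thesis unfolding hamming_dist_def by simp
  qed
  \<comment> \<open>Since m \<ge> 2, position 2 still carries \<open>a\<close>, so a single change
    destroys constancy.\<close>
  have "?a(1 := b) \<notin> ?C"
  proof
    assume "?a(1 := b) \<in> ?C"
    then obtain c where c: "\<forall>i \<in> {1..m}. (?a(1 := b)) i = c" by (rule rep_codeE)
    have "b = c" using bspec[OF c one_in] by simp
    moreover have "a = c" using bspec[OF c two_in] two_in by simp
    ultimately show False using b by simp
  qed
  then have "code_neighbours m Q ?C \<noteq> {}"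
    by (rule code_neighboursI[OF rep_sub rep_codeI[OF a] one_in b(1)])
  moreover have "?a 1 \<noteq> ?b 1" using b one_in by simp
  then have "?a \<noteq> ?b" by (rule contrapos_nn) (rule fun_cong)
  then have "min_distance m ?C = m"
    using dist rep_codeI[OF a] rep_codeI[OF b(1)]
    by (intro min_distance_eqI[OF rep_sub, of ?a ?b]) simp_all
  ultimately show ?thesis
    using code_criterion[OF rep_invariant rep_rigid ne rep_transitive _ rep_neighbours_transitive]
    by blast
qed

subsection \<open>Injective words\<close>

lemma inj_sub: "inj_code m Q \<subseteq> V"
  by (auto simp: inj_code_def)

lemma inj_invariant: "invariant (inj_code m Q)"
proof (rule invariantI[OF inj_sub])
  fix h \<sigma> x assume h: "h permutes Q" and \<sigma>: "\<sigma> permutes {1..m}" and x: "x \<in> inj_code m Q"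
  then have xV: "x \<in> V" and inj: "inj_on x {1..m}" by (simp_all add: inj_code_def)
  have "inj_on (mon h \<sigma> x) {1..m}"
  proof (rule inj_onI)
    fix i j assume ij: "i \<in> {1..m}" "j \<in> {1..m}" "mon h \<sigma> x i = mon h \<sigma> x j"
    then have "x (\<sigma> i) = x (\<sigma> j)"
      using injD[OF permutes_inj[OF h]] by (simp add: mon_apply[OF xV])
    then have "\<sigma> i = \<sigma> j" using inj_onD[OF inj] ij mon_permutes_in[OF \<sigma>] by blast
    then show "i = j" using injD[OF permutes_inj[OF \<sigma>]] by blast
  qed
  then show "mon h \<sigma> x \<in> inj_code m Q" using mon_in[OF h \<sigma> xV] by (simp add: inj_code_def)
qed

lemma inj_transitive: "transitive_on (inj_code m Q)"
  unfolding transitive_on_def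
proof (intro ballI)
  fix x y assume "x \<in> inj_code m Q" "y \<in> inj_code m Q"
  then have V: "x \<in> V" "y \<in> V" and inj: "inj_on x {1..m}" "inj_on y {1..m}"
    by (simp_all add: inj_code_def)
  show "\<exists>g \<in> mons. g x = y"
    by (rule same_kernel_imp_mons[OF V permutes_id])
      (simp add: inj_on_eq_iff[OF inj(1)] inj_on_eq_iff[OF inj(2)])
qed

text \<open>If \<open>h i a\<close> and \<open>h j a\<close> differ, surjectivity of
  \<open>h j\<close> gives \<open>b \<noteq> a\<close> with \<open>h j b = h i a\<close>. A codeword
  with \<open>a\<close> at \<open>i\<close> and \<open>b\<close> at \<open>j\<close> then has an
  image with a repeated letter.\<close>

lemma inj_rigid:
  assumes "x \<in> inj_code m Q"
  shows "rigid (inj_code m Q)"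
proof (rule rigidI, rule ccontr)
  fix \<tau> h i j a
  assume pres: "preserving (inj_code m Q) \<tau> h"
    and ij: "i \<in> {1..m}" "j \<in> {1..m}" "i \<noteq> j" and a: "a \<in> Q" and neq: "h i a \<noteq> h j a"
  note \<tau> = preservingD(1)[OF pres]
  have "h i a \<in> Q" using preservingD(2)[OF pres ij(1)] a by blast
  also have "h j ` Q = Q"
    by (rule endo_inj_surj[OF finite_Q preservingD(2,3)[OF pres ij(2)]])
  then have "Q = h j ` Q" by (rule sym)
  finally obtain b where b: "b \<in> Q" "h j b = h i a" by (metis imageE)
  then have "a \<noteq> b" using neq by auto
  have "inj_on x {1..m}" using assms by (simp add: inj_code_def)
  then have "x 1 \<noteq> x 2" by (simp add: inj_on_eq_iff[OF _ one_in two_in])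
  then obtain z where z: "z \<in> inj_code m Q" "z i = a" "z j = b"
    using invariant_prescribe_two[OF inj_invariant assms one_in two_in _ ij a b(1) \<open>a \<noteq> b\<close>] by blast
  obtain y where y: "y \<in> inj_code m Q" "\<forall>k \<in> {1..m}. y (\<tau> k) = h k (z k)"
    using preservingD(4)[OF pres z(1)] by blast
  have "y (\<tau> i) = y (\<tau> j)" using y(2) ij z b by simp
  moreover have "inj_on y {1..m}" using y(1) by (simp add: inj_code_def)
  ultimately have "\<tau> i = \<tau> j" using bij_betwE[OF \<tau>] ij by (simp add: inj_on_eq_iff)
  then show False using inj_onD[OF bij_betw_imp_inj_on[OF \<tau>] _ ij(1,2)] ij(3) by blast
qed

text \<open>Away from \<open>i\<close> the word agrees with an injective one, so its only repetition
  pairs \<open>i\<close> with a single \<open>j\<close>: one class of size two, all others of size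
  one.\<close>

lemma inj_neighboursE:
  assumes "x \<in> code_neighbours m Q (inj_code m Q)"
  obtains i j where "i \<in> {1..m}" "j \<in> {1..m}" "i \<noteq> j"
    "\<forall>k \<in> {1..m}. \<forall>l \<in> {1..m}. x k = x l \<longleftrightarrow> k = l \<or> (k \<in> {i, j} \<and> l \<in> {i, j})"
proof -
  obtain y i where y: "y \<in> inj_code m Q" and x: "x \<in> V" "x \<notin> inj_code m Q"
    and i: "i \<in> {1..m}" "diffs x y = {i}"
    using assms by (rule code_neighboursE)
  have "inj_on y {1..m}" using y by (simp add: inj_code_def)
  then have inj: "x k \<noteq> x l" if "k \<in> {1..m}" "l \<in> {1..m}" "k \<noteq> i" "l \<noteq> i" "k \<noteq> l" for k l
    using that diffs_singletonD[OF i(2)] inj_on_eq_iff[of y "{1..m}" k l] by simp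
  have "\<not> inj_on x {1..m}" using x by (simp add: inj_code_def)
  then obtain k l where "k \<in> {1..m}" "l \<in> {1..m}" "x k = x l" "k \<noteq> l" unfolding inj_on_def by blast
  then obtain j where j: "j \<in> {1..m}" "x j = x i" "j \<noteq> i" using inj by metis
  have "x k = x l \<longleftrightarrow> k = l \<or> (k \<in> {i, j} \<and> l \<in> {i, j})" if "k \<in> {1..m}" "l \<in> {1..m}" for k l
    using that inj[OF that] inj[OF that(1) j(1)] inj[OF that(2) j(1)] j
    by (cases "k = i"; cases "l = i"; cases "k = j"; cases "l = j") auto
  then show thesis by (intro that[OF i(1) j(1) j(3)[symmetric]] ballI)
qed

lemma inj_neighbours_transitive: "transitive_on (code_neighbours m Q (inj_code m Q))"
  unfolding transitive_on_def
proof (intro ballI)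
  let ?N = "code_neighbours m Q (inj_code m Q)"
  fix x y assume x: "x \<in> ?N" and y: "y \<in> ?N"
  obtain i j where ij: "i \<in> {1..m}" "j \<in> {1..m}" "i \<noteq> j"
    and kx: "\<forall>k \<in> {1..m}. \<forall>l \<in> {1..m}. x k = x l \<longleftrightarrow> k = l \<or> (k \<in> {i, j} \<and> l \<in> {i, j})"
    using x by (rule inj_neighboursE)
  obtain i' j' where ij': "i' \<in> {1..m}" "j' \<in> {1..m}" "i' \<noteq> j'"
    and ky: "\<forall>k \<in> {1..m}. \<forall>l \<in> {1..m}. y k = y l \<longleftrightarrow> k = l \<or> (k \<in> {i', j'} \<and> l \<in> {i', j'})"
    using y by (rule inj_neighboursE)
  obtain \<sigma> where \<sigma>: "\<sigma> permutes {1..m}" "\<sigma> i' = i" "\<sigma> j' = j"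
    by (rule two_points_permutation[OF finite_atLeastAtMost ij' ij])
  have inj: "\<sigma> k = \<sigma> l \<longleftrightarrow> k = l" for k l using permutes_inj[OF \<sigma>(1)] by (simp add: inj_eq)
  have V: "x \<in> V" "y \<in> V" using x y by (simp_all add: code_neighbours_def)
  show "\<exists>g \<in> mons. g x = y"
  proof (rule same_kernel_imp_mons[OF V \<sigma>(1)])
    fix k l assume kl: "k \<in> {1..m}" "l \<in> {1..m}"
    have "\<sigma> k \<in> {i, j} \<longleftrightarrow> k \<in> {i', j'}" for k
      using inj[of k i'] inj[of k j'] \<sigma>(2,3) by simp
    then show "x (\<sigma> k) = x (\<sigma> l) \<longleftrightarrow> y k = y l"
      using bspec[OF bspec[OF ky kl(1)] kl(2)] inj
        bspec[OF bspec[OF kx mon_permutes_in[OF \<sigma>(1) kl(1)]] mon_permutes_in[OF \<sigma>(1) kl(2)]]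
      by simp
  qed
qed

lemma inj_code_theorem:
  assumes "m < card Q"
  shows "neighbour_transitive m Q (inj_code m Q) \<and>
    internal_semidirect_product (code_aut m Q (inj_code m Q)) (diag_group m Q) (entry_perm_group m Q) \<and>
    min_distance m (inj_code m Q) = 1"
proof -
  let ?C = "inj_code m Q"
  have "card {1..m} \<le> card Q" using assms by simp
  from card_le_inj[OF finite_atLeastAtMost finite_Q this]
  obtain f where f: "f ` {1..m} \<subseteq> Q" "inj_on f {1..m}" by blast
  define x where "x = restrict f {1..m}"
  have xV: "x \<in> V" using f(1) by (simp add: x_def hamming_vertices_def image_subset_iff)
  have inj: "inj_on x {1..m}" using f(2) by (simp add: x_def inj_on_restrict_eq)
  have x: "x \<in> ?C" using xV inj by (simp add: inj_code_def)
  \<comment> \<open>\<open>m < card Q\<close> leaves a spare letter; writing it at position 1 gives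
    a second codeword at distance 1.\<close>
  have "card (x ` {1..m}) < card Q" using assms card_image[OF inj] by simp
  then have "\<not> Q \<subseteq> x ` {1..m}" using card_mono[of "x ` {1..m}" Q] by auto
  then obtain c where c: "c \<in> Q" "c \<notin> x ` {1..m}" by blast
  have "inj_on (x(1 := c)) {1..m}" using inj c(2) by (rule inj_on_fun_updI)
  then have xc: "x(1 := c) \<in> ?C" using vertex_upd[OF xV one_in c(1)] by (simp add: inj_code_def)
  have "c \<noteq> x 1" using c(2) one_in by blast
  then have dist: "hamming_dist m x (x(1 := c)) = 1" by (rule hamming_dist_upd[OF one_in])
  have "x \<noteq> x(1 := c)" using \<open>c \<noteq> x 1\<close> by (metis fun_upd_same)
  with dist have "min_distance m ?C = 1"
    using hamming_dist_pos subsetD[OF inj_sub] by (intro min_distance_eqI[OF inj_sub x xc]) simp_all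
  moreover have "x(1 := x 2) \<notin> ?C"
    using inj_on_eq_iff[of "x(1 := x 2)" "{1..m}" 1 2] one_in two_in by (auto simp: inj_code_def)
  then have "code_neighbours m Q ?C \<noteq> {}"
    by (rule code_neighboursI[OF inj_sub x one_in vertex_in[OF xV two_in]])
  ultimately show ?thesis
    using code_criterion[OF inj_invariant inj_rigid[OF x] _ inj_transitive _ inj_neighbours_transitive] x
    by blast
qed

subsection \<open>Words of middle weight\<close>

context
  fixes u v :: 'a and k :: nat
  assumes uv: "u \<noteq> v" and Q_eq: "Q = {u, v}" and m_eq: "m = 2 * k + 1" and k_pos: "1 \<le> k"
begin

abbreviation W :: "(nat \<Rightarrow> 'a) set" where "W \<equiv> middle_weight_code m u v"

lemma W_iff: "x \<in> W \<longleftrightarrow> x \<in> V \<and> (cnt x v = k \<or> cnt x v = k + 1)"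
proof -
  have "(m - 1) div 2 = k" "(m + 1) div 2 = k + 1" using m_eq by simp_all
  then show ?thesis by (simp add: middle_weight_code_def Q_eq)
qed

lemma W_sub: "W \<subseteq> V"
  using W_iff by blast

lemma cnt_u:
  assumes "x \<in> V"
  shows "cnt x u + cnt x v = m"
proof -
  have "{i \<in> {1..m}. x i = u} \<union> {i \<in> {1..m}. x i = v} = {1..m}"
    using vertex_in[OF assms] Q_eq by blast
  moreover have "card ({i \<in> {1..m}. x i = u} \<union> {i \<in> {1..m}. x i = v}) = cnt x u + cnt x v"
    using uv by (intro card_Un_disjoint) auto
  ultimately show ?thesis by simp
qed

text \<open>The weights k and k + 1 are complementary in m = 2k + 1, so the condition on
  \<open>v\<close> is symmetric in the two letters.\<close>

lemma W_cnt:
  assumes "x \<in> W" "c \<in> Q"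
  shows "cnt x c = k \<or> cnt x c = k + 1"
proof -
  have "x \<in> V" and v: "cnt x v = k \<or> cnt x v = k + 1" using assms(1) by (simp_all add: W_iff)
  then have "cnt x u + cnt x v = 2 * k + 1" using cnt_u m_eq by simp
  with v assms(2) show ?thesis unfolding Q_eq by auto
qed

lemma W_invariant: "invariant W"
proof (rule invariantI[OF W_sub])
  fix h \<sigma> x assume h: "h permutes Q" and \<sigma>: "\<sigma> permutes {1..m}" and x: "x \<in> W"
  then have xV: "x \<in> V" using W_sub by blast
  have "inv_into UNIV h v \<in> Q"
    using Q_eq permutes_in_image[OF permutes_inv[OF h], of v] by simp
  then have "cnt x (inv_into UNIV h v) = k \<or> cnt x (inv_into UNIV h v) = k + 1" by (rule W_cnt[OF x])
  then show "mon h \<sigma> x \<in> W"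
    using mon_letter_card[OF h \<sigma> xV, of "inv_into UNIV h v"] mon_in[OF h \<sigma> xV]
    by (simp add: W_iff permutes_inverses[OF h])
qed

text \<open>With two letters the weight determines both multiplicities; equal weights need only an
  entry permutation, complementary weights also the letter swap.\<close>

lemma binary_transitive:
  assumes V: "x \<in> V" "y \<in> V" and cnt: "cnt x v = cnt y v \<or> cnt x v + cnt y v = m"
  shows "\<exists>g \<in> mons. g x = y"
  using cnt
proof
  assume "cnt x v = cnt y v"
  then have "\<And>a. a \<in> Q \<Longrightarrow> cnt y (id a) = cnt x a"
    using cnt_u[OF V(1)] cnt_u[OF V(2)] Q_eq by auto
  then show ?thesis by (rule same_counts_imp_mons[OF V permutes_id])
next
  assume "cnt x v + cnt y v = m"
  then have "cnt y (transpose u v a) = cnt x a" if "a \<in> Q" for a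
    using cnt_u[OF V(1)] cnt_u[OF V(2)] Q_eq that by auto
  moreover have "transpose u v permutes Q" using Q_eq by (intro permutes_swap_id) auto
  ultimately show ?thesis using same_counts_imp_mons[OF V] by blast
qed

lemma W_transitive: "transitive_on W"
  unfolding transitive_on_def
proof (intro ballI)
  fix x y assume "x \<in> W" "y \<in> W"
  then have "x \<in> V" "y \<in> V" "cnt x v = k \<or> cnt x v = k + 1" "cnt y v = k \<or> cnt y v = k + 1"
    by (simp_all add: W_iff)
  then show "\<exists>g \<in> mons. g x = y" using m_eq by (intro binary_transitive) linarith+
qed

text \<open>One changed entry moves the weight by at most one, and it must leave the pair k, k +
  1.\<close>

lemma W_neighbour_cnt:
  assumes "x \<in> code_neighbours m Q W"
  shows "x \<in> V \<and> (cnt x v = k - 1 \<or> cnt x v = k + 2)"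
proof -
  obtain y i where *: "x \<in> V" "x \<notin> W" "y \<in> W" "diffs x y = {i}"
    using assms by (rule code_neighboursE)
  have "diffs y x = {i}" using *(4) by (simp add: diffs_sym)
  then show ?thesis
    using * cnt_diff_singleton(3)[OF *(4), of v] cnt_diff_singleton(3)[of y x i v]
    by (auto simp: W_iff)
qed

lemma W_neighbours_transitive: "transitive_on (code_neighbours m Q W)"
  unfolding transitive_on_def
proof (intro ballI)
  fix x y assume "x \<in> code_neighbours m Q W" "y \<in> code_neighbours m Q W"
  then have "x \<in> V" "y \<in> V" "cnt x v = k - 1 \<or> cnt x v = k + 2" "cnt y v = k - 1 \<or> cnt y v = k + 2"
    using W_neighbour_cnt by blast+
  \<comment> \<open>The two weights are complementary, (k - 1) + (k + 2) = m, where
    \<open>1 \<le> k\<close> makes the subtraction exact.\<close>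
  then show "\<exists>g \<in> mons. g x = y" using m_eq k_pos by (intro binary_transitive) linarith+
qed

text \<open>A chain of words of increasing weight, consecutive ones differing in one entry; it
  supplies codewords, a pair at distance 1, and a neighbour.\<close>

definition initial_word :: "nat \<Rightarrow> nat \<Rightarrow> 'a" where
  "initial_word j = (\<lambda>i\<in>{1..m}. if i \<le> j then v else u)"

lemma initial_word_V: "initial_word j \<in> V"
  using Q_eq by (simp add: initial_word_def hamming_vertices_def)

lemma initial_word_cnt:
  assumes "j \<le> m"
  shows "cnt (initial_word j) v = j"
proof -
  have "{i \<in> {1..m}. initial_word j i = v} = {1..j}"
    using uv assms by (auto simp: initial_word_def atLeastAtMost_iff)
  then show ?thesis by simp
qed

lemma initial_word_upd:
  assumes "j + 1 \<le> m"
  shows "(initial_word j)(j + 1 := v) = initial_word (j + 1)"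
    and "(initial_word (j + 1))(j + 1 := u) = initial_word j"
  using assms by (auto simp: initial_word_def fun_eq_iff restrict_def atLeastAtMost_iff)

lemma initial_word_W: "initial_word k \<in> W" "initial_word (k + 1) \<in> W"
proof -
  have "k \<le> m" "k + 1 \<le> m" by (simp_all add: m_eq)
  then show "initial_word k \<in> W" "initial_word (k + 1) \<in> W"
    by (simp_all add: W_iff initial_word_V initial_word_cnt)
qed

text \<open>With two letters, \<open>h j b\<close> must equal \<open>h i a\<close>, so the swap
  changes a multiplicity by two, but multiplicities in codewords are k or k + 1.\<close>

lemma W_rigid: "rigid W"
proof (rule rigidI, rule ccontr)
  fix \<tau> h i j a
  assume pres: "preserving W \<tau> h"
    and ij: "i \<in> {1..m}" "j \<in> {1..m}" "i \<noteq> j" and a: "a \<in> Q" and neq: "h i a \<noteq> h j a"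
  obtain b where b: "b \<in> Q" "b \<noteq> a" by (rule other_letter)
  have in_Q: "h i a \<in> Q" "h j a \<in> Q" "h j b \<in> Q"
    using preservingD(2)[OF pres] ij a b by blast+
  have "h j b \<noteq> h j a"
    using inj_onD[OF preservingD(3)[OF pres ij(2)] _ b(1) a] b(2) by blast
  then have hb: "h j b = h i a" using in_Q neq unfolding Q_eq by auto
  have mm: "m \<in> {1..m}" using m_ge by (simp add: atLeastAtMost_iff)
  have "k < m" by (simp add: m_eq)
  \<comment> \<open>Since 1 \<le> k < m, this codeword carries \<open>v\<close> at position 1 and
    \<open>u\<close> at position m.\<close>
  then have "initial_word k 1 \<noteq> initial_word k m"
    using one_in mm uv k_pos by (simp add: initial_word_def)
  then obtain y y' where y: "y \<in> W" "y' \<in> W"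
    "cnt y (h i a) = cnt y' (h i a) + (if h j b = h i a then 2 else 1)"
    by (rule preserving_count_jump[OF W_invariant initial_word_W(1) one_in mm _ pres ij(1,2)
          a b(1) b(2)[symmetric] neq])
  then show False using W_cnt[OF y(1) in_Q(1)] W_cnt[OF y(2) in_Q(1)] hb by auto
qed

lemma middle_weight_code_theorem:
  "neighbour_transitive m Q W \<and>
   internal_semidirect_product (code_aut m Q W) (diag_group m Q) (entry_perm_group m Q) \<and>
   min_distance m W = 1"
proof -
  note in_W = initial_word_W
  have k1: "k + 1 \<in> {1..m}" "k \<in> {1..m}" using m_eq k_pos by (simp_all add: atLeastAtMost_iff)
  have "initial_word k (k + 1) = u" using k1 by (simp add: initial_word_def)
  then have "hamming_dist m (initial_word k) (initial_word (k + 1)) = 1"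
    using hamming_dist_upd[OF k1(1), of v "initial_word k"] initial_word_upd(1)[of k] m_eq uv by simp
  moreover have "initial_word k \<noteq> initial_word (k + 1)"
    using initial_word_cnt[of k] initial_word_cnt[of "k + 1"] m_eq by auto
  ultimately have min: "min_distance m W = 1"
    using hamming_dist_pos subsetD[OF W_sub] by (intro min_distance_eqI[OF W_sub in_W]) simp_all
  \<comment> \<open>Erasing the last \<open>v\<close> lowers the weight to k - 1, just below the
    code.\<close>
  have "(initial_word k)(k := u) = initial_word (k - 1)"
    using initial_word_upd(2)[of "k - 1"] m_eq k_pos by simp
  moreover have "cnt (initial_word (k - 1)) v = k - 1"
    by (rule initial_word_cnt) (simp add: m_eq)
  ultimately have "(initial_word k)(k := u) \<notin> W" using k_pos by (auto simp: W_iff)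
  then have "code_neighbours m Q W \<noteq> {}"
    using Q_eq by (intro code_neighboursI[OF W_sub in_W(1) k1(2)]) simp_all
  then show ?thesis
    using code_criterion[OF W_invariant W_rigid _ W_transitive _ W_neighbours_transitive] in_W min
    by blast
qed

end

subsection \<open>Words with constant letter frequencies\<close>

context
  fixes p :: nat
  assumes p_pos: "0 < p" and m_eq: "m = p * card Q"
begin

abbreviation A :: "(nat \<Rightarrow> 'a) set" where "A \<equiv> all_code m p Q"

lemma A_iff: "x \<in> A \<longleftrightarrow> x \<in> V \<and> (\<forall>a \<in> Q. cnt x a = p)"
  by (simp add: all_code_def)

lemma A_sub: "A \<subseteq> V"
  using A_iff by blast

lemma A_cnt: "x \<in> A \<Longrightarrow> a \<in> Q \<Longrightarrow> cnt x a = p"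
  by (simp add: A_iff)

text \<open>Arrange the positions as a grid with p rows and one column per letter, and label each
  position by its column.\<close>

lemma A_nonempty: "A \<noteq> {}"
proof -
  have "card {1..m} = card ({..<p} \<times> Q)" by (simp add: m_eq card_cartesian_product)
  then obtain f where f: "bij_betw f {1..m} ({..<p} \<times> Q)"
    using finite_same_card_bij[of "{1..m}" "{..<p} \<times> Q"] finite_Q by auto
  define x where "x = (\<lambda>i\<in>{1..m}. snd (f i))"
  have fi: "f ` {1..m} = {..<p} \<times> Q" "inj_on f {1..m}" using f by (simp_all add: bij_betw_def)
  have "snd (f i) \<in> Q" if "i \<in> {1..m}" for i
  proof -
    have "f i \<in> {..<p} \<times> Q" using that unfolding fi(1)[symmetric] by (rule imageI)
    then show ?thesis by (simp add: mem_Times_iff)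
  qed
  then have xV: "x \<in> V" by (simp add: x_def hamming_vertices_def)
  have "cnt x a = p" if "a \<in> Q" for a
  proof -
    have "f ` {i \<in> {1..m}. x i = a} = {z \<in> f ` {1..m}. snd z = a}"
      by (auto simp: x_def)
    also have "\<dots> = {..<p} \<times> {a}" unfolding fi(1) using that by auto
    finally have "card (f ` {i \<in> {1..m}. x i = a}) = p" by (simp add: card_cartesian_product)
    moreover have "inj_on f {i \<in> {1..m}. x i = a}" by (rule inj_on_subset[OF fi(2)]) blast
    ultimately show ?thesis by (simp add: card_image)
  qed
  with xV have "x \<in> A" by (simp add: A_iff)
  then show ?thesis by blast
qed

lemma A_invariant: "invariant A"
proof (rule invariantI[OF A_sub])
  fix h \<sigma> x assume h: "h permutes Q" and \<sigma>: "\<sigma> permutes {1..m}" and x: "x \<in> A"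
  then have xV: "x \<in> V" using A_sub by blast
  have "cnt (mon h \<sigma> x) b = p" if "b \<in> Q" for b
  proof -
    have "inv_into UNIV h b \<in> Q" using that by (simp only: permutes_in_image[OF permutes_inv[OF h]])
    then show ?thesis
      using mon_letter_card[OF h \<sigma> xV, of "inv_into UNIV h b"] A_cnt[OF x]
      by (simp add: permutes_inverses[OF h])
  qed
  then show "mon h \<sigma> x \<in> A" using mon_in[OF h \<sigma> xV] by (simp add: A_iff)
qed

lemma A_transitive: "transitive_on A"
  unfolding transitive_on_def
proof (intro ballI)
  fix x y assume x: "x \<in> A" and y: "y \<in> A"
  show "\<exists>g \<in> mons. g x = y"
    by (rule same_counts_imp_mons[OF subsetD[OF A_sub x] subsetD[OF A_sub y] permutes_id])
      (simp add: A_cnt x y)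
qed

text \<open>The letter \<open>x i\<close> would lose an occurrence, but it occurs p times in both
  words. Hence distance 1 is impossible, and changing one entry leaves the code.\<close>

lemma A_diffs_not_singleton:
  assumes "x \<in> A" "y \<in> A"
  shows "diffs x y \<noteq> {i}"
proof
  assume eq: "diffs x y = {i}"
  then have "i \<in> {1..m}" using diffs_subset[of x y] by blast
  then have "x i \<in> Q" using vertex_in assms(1) A_sub by blast
  then show False using cnt_diff_singleton(1)[OF eq] A_cnt assms by simp
qed

lemma A_word_two_letters:
  obtains x r s where "x \<in> A" "r \<in> {1..m}" "s \<in> {1..m}" "x r \<noteq> x s"
proof -
  obtain x where x: "x \<in> A" using A_nonempty by blast
  then have x1: "x 1 \<in> Q" using vertex_in[OF _ one_in] A_sub by blast
  obtain b where b: "b \<in> Q" "b \<noteq> x 1" by (rule other_letter)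
  have "{i \<in> {1..m}. x i = b} \<noteq> {}" using A_cnt[OF x b(1)] p_pos by (metis card.empty less_irrefl)
  then obtain s where "s \<in> {1..m}" "x s = b" by blast
  with b x one_in that show thesis by metis
qed

text \<open>\<open>a\<close> is the surplus letter \<open>x i\<close> and \<open>b\<close> the
  deficient letter \<open>y i\<close> that it replaced; \<open>cnt x b + 1 = p\<close> avoids
  truncated subtraction.\<close>

lemma A_neighboursE:
  assumes "x \<in> code_neighbours m Q A"
  obtains a b where "x \<in> V" "a \<in> Q" "b \<in> Q" "a \<noteq> b" "cnt x a = p + 1" "cnt x b + 1 = p"
    "\<forall>c \<in> Q - {a, b}. cnt x c = p"
proof -
  obtain y i where x: "x \<in> V" and y: "y \<in> A" and i: "i \<in> {1..m}" "diffs x y = {i}"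
    using assms by (rule code_neighboursE)
  have yV: "y \<in> V" using y A_sub by blast
  have Q: "x i \<in> Q" "y i \<in> Q" using vertex_in[OF x i(1)] vertex_in[OF yV i(1)] by simp_all
  have "i \<in> diffs x y" using i(2) by simp
  then have neq: "x i \<noteq> y i" by (simp add: diffs_def)
  have i': "diffs y x = {i}" using i(2) by (simp add: diffs_sym)
  show thesis
  proof
    show "cnt x (x i) = p + 1" using cnt_diff_singleton(1)[OF i(2)] A_cnt[OF y Q(1)] by simp
    show "cnt x (y i) + 1 = p" using cnt_diff_singleton(1)[OF i'] A_cnt[OF y Q(2)] by simp
    show "\<forall>c \<in> Q - {x i, y i}. cnt x c = p"
      using cnt_diff_singleton(2)[OF i(2)] A_cnt[OF y] by simp
  qed (use x Q neq in simp_all)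
qed

lemma A_neighbours_transitive: "transitive_on (code_neighbours m Q A)"
  unfolding transitive_on_def
proof (intro ballI)
  fix x y assume "x \<in> code_neighbours m Q A" and y: "y \<in> code_neighbours m Q A"
  from this(1) obtain a b where xV: "x \<in> V" and ab: "a \<in> Q" "b \<in> Q" "a \<noteq> b"
    and x: "cnt x a = p + 1" "cnt x b + 1 = p" "\<forall>c \<in> Q - {a, b}. cnt x c = p"
    by (rule A_neighboursE)
  from y obtain a' b' where yV: "y \<in> V" and ab': "a' \<in> Q" "b' \<in> Q" "a' \<noteq> b'"
    and y: "cnt y a' = p + 1" "cnt y b' + 1 = p" "\<forall>c \<in> Q - {a', b'}. cnt y c = p"
    by (rule A_neighboursE)
  \<comment> \<open>Surplus letter goes to surplus letter and deficient to deficient; all other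
    letters occur p times.\<close>
  obtain h where h: "h permutes Q" "h a = a'" "h b = b'"
    by (rule two_points_permutation[OF finite_Q ab ab'])
  show "\<exists>g \<in> mons. g x = y"
  proof (rule same_counts_imp_mons[OF xV yV h(1)])
    fix c assume c: "c \<in> Q"
    show "cnt y (h c) = cnt x c"
    proof (cases "c \<in> {a, b}")
      case True
      then show ?thesis using h x y by auto
    next
      case False
      then have "h c \<noteq> a'" "h c \<noteq> b'" using h(2,3) injD[OF permutes_inj[OF h(1)]] by blast+
      moreover have "h c \<in> Q" using c by (simp only: permutes_in_image[OF h(1)])
      ultimately show ?thesis using x(3) y(3) c False by simp
    qed
  qed
qed

text \<open>All multiplicities equal p, so a jump by either amount is contradictory.\<close>

lemma A_rigid: "rigid A"
proof (rule rigidI, rule ccontr)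
  fix \<tau> h i j a
  assume pres: "preserving A \<tau> h"
    and ij: "i \<in> {1..m}" "j \<in> {1..m}" "i \<noteq> j" and a: "a \<in> Q" and neq: "h i a \<noteq> h j a"
  obtain b where b: "b \<in> Q" "b \<noteq> a" by (rule other_letter)
  obtain x r s where x: "x \<in> A" "r \<in> {1..m}" "s \<in> {1..m}" "x r \<noteq> x s"
    by (rule A_word_two_letters)
  have in_Q: "h i a \<in> Q" using preservingD(2)[OF pres ij(1)] a by blast
  obtain y y' where y: "y \<in> A" "y' \<in> A"
    "cnt y (h i a) = cnt y' (h i a) + (if h j b = h i a then 2 else 1)"
    by (rule preserving_count_jump[OF A_invariant x pres ij(1,2) a b(1) b(2)[symmetric] neq])
  then show False using A_cnt[OF y(1) in_Q] A_cnt[OF y(2) in_Q] by (simp split: if_splits)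
qed

lemma all_code_theorem:
  "neighbour_transitive m Q A \<and>
   internal_semidirect_product (code_aut m Q A) (diag_group m Q) (entry_perm_group m Q) \<and>
   min_distance m A = 2"
proof -
  obtain x r s where x: "x \<in> A" "r \<in> {1..m}" "s \<in> {1..m}" "x r \<noteq> x s"
    by (rule A_word_two_letters)
  have xV: "x \<in> V" using x(1) A_sub by blast
  have "r \<noteq> s" using x(4) by auto
  have tr: "transpose r s permutes {1..m}" using x(2,3) by (intro permutes_swap_id)
  \<comment> \<open>Swapping two distinct letters keeps all multiplicities and changes exactly two
    entries, so distance 2 is attained.\<close>
  define y where "y = mon id (transpose r s) x"
  have y: "y \<in> A" unfolding y_def by (rule invariantD[OF A_invariant x(1) permutes_id tr])
  have yi: "y i = x (transpose r s i)" if "i \<in> {1..m}" for i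
    unfolding y_def by (simp add: mon_apply[OF xV that])
  have "diffs x y = {r, s}"
  proof (rule Set.set_eqI)
    fix i
    show "i \<in> diffs x y \<longleftrightarrow> i \<in> {r, s}"
      using x(2-4) yi[of i] by (cases "i = r"; cases "i = s") (auto simp: diffs_def)
  qed
  then have dist: "hamming_dist m x y = 2" using \<open>r \<noteq> s\<close> by (simp add: hamming_dist_eq)
  have "x \<noteq> y" using yi[OF x(2)] x(4) by auto
  moreover have "2 \<le> hamming_dist m x y" if "x \<in> A" "y \<in> A" "x \<noteq> y" for x y
  proof -
    have "hamming_dist m x y \<noteq> 1"
      using A_diffs_not_singleton[OF that(1,2)] card_1_singletonE[of "diffs x y"]
      unfolding hamming_dist_eq by metis
    moreover have "1 \<le> hamming_dist m x y" using hamming_dist_pos that A_sub by blast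
    ultimately show ?thesis by simp
  qed
  ultimately have "min_distance m A = 2"
    using dist by (intro min_distance_eqI[OF A_sub x(1) y]) simp_all
  moreover have "diffs x (x(r := x s)) = {r}" using x by (intro diffs_upd) auto
  then have "x(r := x s) \<notin> A" using A_diffs_not_singleton[OF x(1)] by blast
  then have "code_neighbours m Q A \<noteq> {}"
    by (rule code_neighboursI[OF A_sub x(1,2) vertex_in[OF xV x(3)]])
  ultimately show ?thesis
    using code_criterion[OF A_invariant A_rigid A_nonempty A_transitive _ A_neighbours_transitive]
    by blast
qed

end

end

theorem theorem3p3:
  fixes m q d :: nat and Q :: "'a set" and C :: "(nat \<Rightarrow> 'a) set"
  assumes "m \<ge> 2" and "q \<ge> 2" and "finite Q" and "card Q = q"
    and "(C = rep_code m Q \<and> d = m)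
       \<or> (m < q \<and> C = inj_code m Q \<and> d = 1)
       \<or> (q = 2 \<and> m \<ge> 3 \<and> odd m \<and>
            (\<exists>u v. u \<noteq> v \<and> Q = {u, v} \<and> C = middle_weight_code m u v) \<and> d = 1)
       \<or> ((\<exists>p > 0. m = p * q \<and> C = all_code m p Q) \<and> d = 2)"
  shows "neighbour_transitive m Q C
       \<and> internal_semidirect_product (code_aut m Q C) (diag_group m Q) (entry_perm_group m Q)
       \<and> min_distance m C = d"
proof -
  interpret hamming_graph m Q
    using assms(1-4) by unfold_locales simp_all
  from assms(5) consider "C = rep_code m Q" "d = m"
    | "m < q" "C = inj_code m Q" "d = 1"
    | u v where "m \<ge> 3" "odd m" "u \<noteq> v" "Q = {u, v}" "C = middle_weight_code m u v" "d = 1"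
    | p where "p > 0" "m = p * q" "C = all_code m p Q" "d = 2"
    by blast
  then show ?thesis
  proof cases
    case 1
    then show ?thesis using rep_code_theorem by simp
  next
    case 2
    then show ?thesis using inj_code_theorem assms(4) by simp
  next
    case 3
    from \<open>odd m\<close> obtain k where k: "m = 2 * k + 1" by (rule oddE)
    with \<open>m \<ge> 3\<close> have "1 \<le> k" by simp
    then show ?thesis using middle_weight_code_theorem[OF 3(3,4) k] 3(5,6) by simp
  next
    case 4
    then show ?thesis using all_code_theorem[of p] assms(4) by simp
  qed
qed

end
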